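(* Let $G$ be a finite group and let $\mathscr{C}$ be any set of subgroups of $G$ closed under conjugation. Then the $G$-category $E\mathcal{A}_{\mathscr{C}}$ has series Lefschetz invariant $$\Lambda_{\Sigma}(E\mathcal{A}_{\mathscr{C}})=\sum_{H\in\mathscr{C}}\frac{-\mu_{\mathscr{C}_{-}}(-\infty,H)}{|G:C_G(H)|}\,[G/C_G(H)]\ \in\ \Omega(G),$$ where $\mathscr{C}_{-}$ is the poset obtained from $\mathscr{C}$ (ordered by inclusion) by adding a unique minimum element $-\infty$, and $\mu_{\mathscr{C}_{-}}$ is its Möbius function.
   Context: $\Omega(G)=\mathbb{Q}\otimes_{\mathbb{Z}}\Omega_{\mathbb{Z}}(G)$ is the rational Burnside ring of $G$; $[X]$ denotes the class of a finite $G$-set $X$. $C_G(H)$ is the centralizer of $H$ in $G$. Series Lefschetz invariant: let $\mathsf{D}$ be a finite category (finitely many objects and morphisms) with a $G$-action. For $n\ge 0$ let $\mathsf{D}_n$ be the finite $G$-set of non-degenerate $n$-simplices of the nerve of $\mathsf{D}$, i.e. of chains of $n$ composable non-identity morphisms ($\mathsf{D}_0=\mathrm{Obj}(\mathsf{D})$). Put $f_{\mathsf{D}}(t)=\sum_{n\ge0}[\mathsf{D}_n]t^n\in\Omega(G)[[t]]\cong\Omega(G)\otimes_{\mathbb{Q}}\mathbb{Q}[[t]]$. Let $\mathbb{Q}[t]_{(t+1)}$ be the ring of rational functions $p/q$ with $(t+1)\nmid q$. $\mathsf{D}$ has series Lefschetz invariant if $f_{\mathsf{D}}\in\Omega(G)\otimes_{\mathbb{Q}}\mathbb{Q}[t]_{(t+1)}$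 (power series and rational functions being compared inside Laurent series), and then $\Lambda_{\Sigma}(\mathsf{D}):=f_{\mathsf{D}}(-1)\in\Omega(G)$. The fusion category $\mathcal{F}_{\mathscr{C}}$ has object set $\mathscr{C}$, and the morphisms from $L$ to $K$ are the group homomorphisms $L\to K$ of the form $x\mapsto gxg^{-1}$ for some $g\in G$ (with $gLg^{-1}\le K$). Let $v:\mathcal{F}_{\mathscr{C}}^{\mathrm{op}}\to G\text{-sets}$ be the functor $K\mapsto G/C_G(K)$ sending the morphism $L\to K$, $x\mapsto gxg^{-1}$, to the $G$-map $G/C_G(K)\to G/C_G(L)$ determined by $C_G(K)\mapsto gC_G(L)$. The $G$-category $E\mathcal{A}_{\mathscr{C}}$ is the Grothendieck construction of $v$: its objects are pairs $(K,a)$ with $K\in\mathscr{C}$, $a\in G/C_G(K)$; a morphism $(K,a)\to(L,b)$ is a morphism $\varphi:K\to L$ of $\mathcal{F}_{\mathscr{C}}^{\mathrm{op}}$ with $v(\varphi)(a)=b$; $G$ acts by $g\cdot(K,a)=(K,ga)$ on objects, and $g$ sends the morphism $(K,a)\to(L,b)$ given by $\varphi$ to the morphism $(K,ga)\to(L,gb)$ given by $\varphi$. *)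

theory Defs
  imports
    "HOL-Library.Poly_Mapping"
    "HOL-Library.Option_ord"
    "HOL-Computational_Algebra.Computational_Algebra"
    "HOL-Computational_Algebra.Field_as_Ring"
    "HOL-Algebra.Group_Action"
    "HOL-Algebra.Left_Coset"
    "HOL-Algebra.QuotRing"
    "HOL-Algebra.Module"
begin

section \<open>The rational Burnside ring\<close>

text \<open>A \<open>G\<close>-set is a pair of an underlying set and an action in the sense of
  \<^locale>\<open>group_action\<close>; in particular the maps \<open>snd X g\<close> are extensional on \<open>fst X\<close>.\<close>

type_synonym ('g, 'x) gset = "'x set \<times> ('g \<Rightarrow> 'x \<Rightarrow> 'x)"

definition finite_gset :: "('g, 'k) monoid_scheme \<Rightarrow> ('g, 'x) gset \<Rightarrow> bool"
  where "finite_gset G X \<longleftrightarrow> finite (fst X) \<and> group_action G (fst X) (snd X)"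

definition gset_iso :: "('g, 'k) monoid_scheme \<Rightarrow> ('g, 'x) gset \<Rightarrow> ('g, 'y) gset \<Rightarrow> bool"
  where "gset_iso G X Y \<longleftrightarrow>
    (\<exists>f. bij_betw f (fst X) (fst Y) \<and>
         (\<forall>g\<in>carrier G. \<forall>x\<in>fst X. f (snd X g x) = snd Y g (f x)))"

definition gset_sum :: "('g, 'x) gset \<Rightarrow> ('g, 'y) gset \<Rightarrow> ('g, 'x + 'y) gset"
  where "gset_sum X Y =
    (Inl ` fst X \<union> Inr ` fst Y,
     \<lambda>g. restrict (map_sum (snd X g) (snd Y g)) (Inl ` fst X \<union> Inr ` fst Y))"

definition gset_prod :: "('g, 'x) gset \<Rightarrow> ('g, 'y) gset \<Rightarrow> ('g, 'x \<times> 'y) gset"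
  where "gset_prod X Y =
    (fst X \<times> fst Y, \<lambda>g. restrict (map_prod (snd X g) (snd Y g)) (fst X \<times> fst Y))"

definition gset_point :: "('g, unit) gset"
  where "gset_point = ({()}, \<lambda>g. \<lambda>x\<in>{()}. x)"

text \<open>Every finite \<open>G\<close>-set, over whatever type, has an isomorphic copy whose underlying set
  consists of natural numbers. The isomorphism class of \<open>X\<close> is the set of all these copies, so
  that two finite \<open>G\<close>-sets have the same class iff they are isomorphic, even if they live on
  different types.\<close>

type_synonym 'g gset_class = "('g, nat) gset set"

definition iso_class :: "('g, 'k) monoid_scheme \<Rightarrow> ('g, 'x) gset \<Rightarrow> 'g gset_class"
  where "iso_class G X = {Y. finite_gset G Y \<and> gset_iso G X Y}"

definition iso_classes :: "('g, 'k) monoid_scheme \<Rightarrow> 'g gset_class set"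
  where "iso_classes G = {iso_class G X |X :: ('g, nat) gset. finite_gset G X}"

definition class_prod ::
    "('g, 'k) monoid_scheme \<Rightarrow> 'g gset_class \<Rightarrow> 'g gset_class \<Rightarrow> 'g gset_class"
  where "class_prod G c d = (\<Union>X\<in>c. \<Union>Y\<in>d. iso_class G (gset_prod X Y))"

text \<open>\<open>\<rat>\<close>-linear combinations of isomorphism classes, with the multiplication extending the
  Cartesian product bilinearly.\<close>

definition free_burnside :: "('g, 'k) monoid_scheme \<Rightarrow> ('g gset_class \<Rightarrow>\<^sub>0 rat) ring"
  where "free_burnside G =
    \<lparr>carrier = {u. Poly_Mapping.keys u \<subseteq> iso_classes G},
     mult = (\<lambda>u v. \<Sum>c\<in>Poly_Mapping.keys u. \<Sum>d\<in>Poly_Mapping.keys v.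
        Poly_Mapping.single (class_prod G c d)
          (Poly_Mapping.lookup u c * Poly_Mapping.lookup v d)),
     one = Poly_Mapping.single (iso_class G gset_point) 1,
     zero = 0,
     add = (+)\<rparr>"

abbreviation scale :: "rat \<Rightarrow> ('a \<Rightarrow>\<^sub>0 rat) \<Rightarrow> ('a \<Rightarrow>\<^sub>0 rat)"
  where "scale c \<equiv> Poly_Mapping.map ((*) c)"

definition burnside_relations :: "('g, 'k) monoid_scheme \<Rightarrow> ('g gset_class \<Rightarrow>\<^sub>0 rat) set"
  where "burnside_relations G = module.span scale
    {Poly_Mapping.single (iso_class G (gset_sum X Y)) 1
       - Poly_Mapping.single (iso_class G X) 1 - Poly_Mapping.single (iso_class G Y) 1
     | (X :: ('g, nat) gset) (Y :: ('g, nat) gset). finite_gset G X \<and> finite_gset G Y}"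

text \<open>The integral Burnside ring is the free abelian group on the isomorphism classes modulo the
  relations \<open>[X \<squnion> Y] = [X] + [Y]\<close>. Since \<open>\<rat> \<otimes> -\<close> is right exact and commutes with direct sums,
  the rational one is the free \<open>\<rat>\<close>-vector space on the classes modulo the \<open>\<rat>\<close>-span of these
  relations. The quotient ring is extended by the scalar multiplication of \<open>\<rat>\<close>.\<close>

definition burnside_ring ::
    "('g, 'k) monoid_scheme \<Rightarrow> (rat, ('g gset_class \<Rightarrow>\<^sub>0 rat) set) module"
  where "burnside_ring G =
    ring.extend (free_burnside G Quot burnside_relations G)
      (module.fields
        (\<lambda>c A. \<Union>u\<in>A. burnside_relations G +>\<^bsub>free_burnside G\<^esub> scale c u))"

definition burnside_class ::
    "('g, 'k) monoid_scheme \<Rightarrow> ('g, 'x) gset \<Rightarrow> ('g gset_class \<Rightarrow>\<^sub>0 rat) set"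
  where "burnside_class G X =
    burnside_relations G +>\<^bsub>free_burnside G\<^esub> Poly_Mapping.single (iso_class G X) 1"


section \<open>Finite categories with a group action\<close>

record ('o, 'm) category =
  obj :: "'o set"
  arr :: "'m set"
  src :: "'m \<Rightarrow> 'o"
  tgt :: "'m \<Rightarrow> 'o"
  idn :: "'o \<Rightarrow> 'm"
  arr_comp :: "'m \<Rightarrow> 'm \<Rightarrow> 'm"  \<comment> \<open>\<open>arr_comp D n m\<close> is \<open>n\<close> after \<open>m\<close>\<close>

locale finite_category =
  fixes D :: "('o, 'm, 'z) category_scheme"
  assumes finite_obj: "finite (obj D)"
    and finite_arr: "finite (arr D)"
    and src_closed: "m \<in> arr D \<Longrightarrow> src D m \<in> obj D"
    and tgt_closed: "m \<in> arr D \<Longrightarrow> tgt D m \<in> obj D"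
    and idn_closed: "x \<in> obj D \<Longrightarrow> idn D x \<in> arr D"
    and src_idn: "x \<in> obj D \<Longrightarrow> src D (idn D x) = x"
    and tgt_idn: "x \<in> obj D \<Longrightarrow> tgt D (idn D x) = x"
    and comp_closed: "\<lbrakk>m \<in> arr D; n \<in> arr D; tgt D m = src D n\<rbrakk> \<Longrightarrow> arr_comp D n m \<in> arr D"
    and src_comp: "\<lbrakk>m \<in> arr D; n \<in> arr D; tgt D m = src D n\<rbrakk> \<Longrightarrow> src D (arr_comp D n m) = src D m"
    and tgt_comp: "\<lbrakk>m \<in> arr D; n \<in> arr D; tgt D m = src D n\<rbrakk> \<Longrightarrow> tgt D (arr_comp D n m) = tgt D n"
    and comp_idn_right: "m \<in> arr D \<Longrightarrow> arr_comp D m (idn D (src D m)) = m"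
    and comp_idn_left: "m \<in> arr D \<Longrightarrow> arr_comp D (idn D (tgt D m)) m = m"
    and comp_assoc:
      "\<lbrakk>l \<in> arr D; m \<in> arr D; n \<in> arr D; tgt D l = src D m; tgt D m = src D n\<rbrakk>
        \<Longrightarrow> arr_comp D n (arr_comp D m l) = arr_comp D (arr_comp D n m) l"

record ('o, 'm, 'g) gcategory = "('o, 'm) category" +
  obj_act :: "'g \<Rightarrow> 'o \<Rightarrow> 'o"
  arr_act :: "'g \<Rightarrow> 'm \<Rightarrow> 'm"

locale finite_gcategory = finite_category D
  for G :: "('g, 'k) monoid_scheme" and D :: "('o, 'm, 'g, 'z) gcategory_scheme" +
  assumes obj_action: "group_action G (obj D) (obj_act D)"
    and arr_action: "group_action G (arr D) (arr_act D)"
    and src_act: "\<lbrakk>g \<in> carrier G; m \<in> arr D\<rbrakk> \<Longrightarrow> src D (arr_act D g m) = obj_act D g (src D m)"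
    and tgt_act: "\<lbrakk>g \<in> carrier G; m \<in> arr D\<rbrakk> \<Longrightarrow> tgt D (arr_act D g m) = obj_act D g (tgt D m)"
    and idn_act: "\<lbrakk>g \<in> carrier G; x \<in> obj D\<rbrakk> \<Longrightarrow> arr_act D g (idn D x) = idn D (obj_act D g x)"
    and comp_act:
      "\<lbrakk>g \<in> carrier G; m \<in> arr D; n \<in> arr D; tgt D m = src D n\<rbrakk>
        \<Longrightarrow> arr_act D g (arr_comp D n m) = arr_comp D (arr_act D g n) (arr_act D g m)"


section \<open>The series Lefschetz invariant\<close>

fun nondeg_chain :: "('o, 'm, 'z) category_scheme \<Rightarrow> 'o \<Rightarrow> 'm list \<Rightarrow> bool"
  where
    "nondeg_chain D x [] \<longleftrightarrow> x \<in> obj D"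
  | "nondeg_chain D x (m # ms) \<longleftrightarrow>
      m \<in> arr D \<and> src D m = x \<and> m \<noteq> idn D x \<and> nondeg_chain D (tgt D m) ms"

text \<open>A simplex is a chain of arrows together with its initial object. The latter is redundant
  except in dimension \<open>0\<close>, where the simplices are \<open>(x, [])\<close> for the objects \<open>x\<close>.\<close>

definition simplices :: "('o, 'm, 'z) category_scheme \<Rightarrow> nat \<Rightarrow> ('o \<times> 'm list) set"
  where "simplices D n = {(x, ms). length ms = n \<and> nondeg_chain D x ms}"

definition simplex_gset ::
    "('o, 'm, 'g, 'z) gcategory_scheme \<Rightarrow> nat \<Rightarrow> ('g, 'o \<times> 'm list) gset"
  where "simplex_gset D n =
    (simplices D n, \<lambda>g. restrict (map_prod (obj_act D g) (map (arr_act D g))) (simplices D n))"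

text \<open>The coefficient at \<open>t\<^sup>n\<close> of \<open>f\<^sub>D(t)\<close>, seen as a Laurent series.\<close>

definition simplex_series ::
    "('g, 'k) monoid_scheme \<Rightarrow> ('o, 'm, 'g, 'z) gcategory_scheme
      \<Rightarrow> int \<Rightarrow> ('g gset_class \<Rightarrow>\<^sub>0 rat) set"
  where "simplex_series G D n =
    (if n < 0 then \<zero>\<^bsub>burnside_ring G\<^esub> else burnside_class G (simplex_gset D (nat n)))"

text \<open>Rational functions \<open>p/q\<close> with \<open>(t + 1) \<nmid> q\<close>. The functions \<open>ratfun_laurent\<close> and
  \<open>ratfun_eval\<close> use the reduced fraction representing a rational function.\<close>

definition regular_at_minus_one :: "rat poly fract set"
  where "regular_at_minus_one = {Fract p q |p q. \<not> [:1, 1:] dvd q}"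

definition ratfun_laurent :: "rat poly fract \<Rightarrow> rat fls"
  where "ratfun_laurent r =
    (case quot_of_fract r of
      (p, q) \<Rightarrow> fps_to_fls (fps_of_poly p) / fps_to_fls (fps_of_poly q))"

definition ratfun_eval :: "rat poly fract \<Rightarrow> rat \<Rightarrow> rat"
  where "ratfun_eval r a = (case quot_of_fract r of (p, q) \<Rightarrow> poly p a / poly q a)"

text \<open>\<open>f\<close> is the image in \<open>\<Omega>(G) \<otimes> \<rat>((t))\<close> of \<open>\<Sum>i<k. w i \<otimes> r i\<close>, an element of the tensor product
  of \<open>\<Omega>(G)\<close> with the rational functions that are regular at \<open>-1\<close>, and \<open>v\<close> is the value of this
  tensor at \<open>-1\<close>. As \<open>\<Omega>(G) \<otimes> \<rat>((t))\<close> embeds into \<open>\<Omega>(G)((t))\<close>, the comparison is made coefficientwise.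
  The value only depends on \<open>f\<close>, because the tensor product with the regular rational functions
  embeds as well.\<close>

definition has_value_at_minus_one ::
    "('g, 'k) monoid_scheme \<Rightarrow> (int \<Rightarrow> ('g gset_class \<Rightarrow>\<^sub>0 rat) set)
      \<Rightarrow> ('g gset_class \<Rightarrow>\<^sub>0 rat) set \<Rightarrow> bool"
  where "has_value_at_minus_one G f v \<longleftrightarrow>
    (\<exists>(k::nat) w r.
      (\<forall>i<k. w i \<in> carrier (burnside_ring G) \<and> r i \<in> regular_at_minus_one) \<and>
      (\<forall>n. f n = (\<Oplus>\<^bsub>burnside_ring G\<^esub> i\<in>{..<k}.
                    fls_nth (ratfun_laurent (r i)) n \<odot>\<^bsub>burnside_ring G\<^esub> w i)) \<and>
      v = (\<Oplus>\<^bsub>burnside_ring G\<^esub> i\<in>{..<k}. ratfun_eval (r i) (- 1) \<odot>\<^bsub>burnside_ring G\<^esub> w i))"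

definition has_series_lefschetz ::
    "('g, 'k) monoid_scheme \<Rightarrow> ('o, 'm, 'g, 'z) gcategory_scheme \<Rightarrow> bool"
  where "has_series_lefschetz G D \<longleftrightarrow>
    finite_gcategory G D \<and> (\<exists>v. has_value_at_minus_one G (simplex_series G D) v)"

definition series_lefschetz ::
    "('g, 'k) monoid_scheme \<Rightarrow> ('o, 'm, 'g, 'z) gcategory_scheme
      \<Rightarrow> ('g gset_class \<Rightarrow>\<^sub>0 rat) set"
  where "series_lefschetz G D = (THE v. has_value_at_minus_one G (simplex_series G D) v)"


section \<open>The category \<open>E\<A>\<^sub>C\<close>\<close>

definition centralizer :: "('g, 'k) monoid_scheme \<Rightarrow> 'g set \<Rightarrow> 'g set"
  where "centralizer G H = {g \<in> carrier G. \<forall>h\<in>H. g \<otimes>\<^bsub>G\<^esub> h = h \<otimes>\<^bsub>G\<^esub> g}"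

definition coset_gset :: "('g, 'k) monoid_scheme \<Rightarrow> 'g set \<Rightarrow> ('g, 'g set) gset"
  where "coset_gset G H = (lcosets\<^bsub>G\<^esub> H, \<lambda>g. \<lambda>a\<in>lcosets\<^bsub>G\<^esub> H. g <#\<^bsub>G\<^esub> a)"

definition conj_hom :: "('g, 'k) monoid_scheme \<Rightarrow> 'g set \<Rightarrow> 'g \<Rightarrow> 'g \<Rightarrow> 'g"
  where "conj_hom G L g = (\<lambda>x\<in>L. g \<otimes>\<^bsub>G\<^esub> x \<otimes>\<^bsub>G\<^esub> inv\<^bsub>G\<^esub> g)"

text \<open>A morphism is a triple consisting of source, target and underlying homomorphism.\<close>

definition fusion_category ::
    "('g, 'k) monoid_scheme \<Rightarrow> 'g set set \<Rightarrow> ('g set, 'g set \<times> 'g set \<times> ('g \<Rightarrow> 'g)) category"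
  where "fusion_category G C =
    \<lparr>obj = C,
     arr = {(L, K, conj_hom G L g) |L K g.
              L \<in> C \<and> K \<in> C \<and> g \<in> carrier G \<and> conj_hom G L g ` L \<subseteq> K},
     src = (\<lambda>(L, K, \<phi>). L),
     tgt = (\<lambda>(L, K, \<phi>). K),
     idn = (\<lambda>L. (L, L, \<lambda>x\<in>L. x)),
     arr_comp = (\<lambda>(K, M, \<psi>) (L, K', \<phi>). (L, M, compose L \<psi> \<phi>))\<rparr>"

definition op_category :: "('o, 'm) category \<Rightarrow> ('o, 'm) category"
  where "op_category D =
    \<lparr>obj = obj D, arr = arr D, src = tgt D, tgt = src D, idn = idn D,
     arr_comp = (\<lambda>n m. arr_comp D m n)\<rparr>"

text \<open>The Grothendieck construction of a functor from \<open>D\<close> to \<open>G\<close>-sets, given by \<open>V\<close> on objects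
  and \<open>v\<close> on morphisms. A morphism is a triple consisting of source, underlying morphism of \<open>D\<close>
  and target.\<close>

definition grothendieck ::
    "('o, 'm) category \<Rightarrow> ('o \<Rightarrow> ('g, 'x) gset) \<Rightarrow> ('m \<Rightarrow> 'x \<Rightarrow> 'x)
      \<Rightarrow> ('o \<times> 'x, ('o \<times> 'x) \<times> 'm \<times> ('o \<times> 'x), 'g) gcategory"
  where "grothendieck D V v =
    (let Ob = (SIGMA K:obj D. fst (V K));
         Ar = {((K, a), \<phi>, (L, b)) |K a \<phi> L b.
                 (K, a) \<in> Ob \<and> (L, b) \<in> Ob \<and> \<phi> \<in> arr D \<and> src D \<phi> = K \<and> tgt D \<phi> = L \<and> v \<phi> a = b}
     in \<lparr>obj = Ob,
         arr = Ar,
         src = (\<lambda>(x, \<phi>, y). x),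
         tgt = (\<lambda>(x, \<phi>, y). y),
         idn = (\<lambda>(K, a). ((K, a), idn D K, (K, a))),
         arr_comp = (\<lambda>(y, \<psi>, z) (x, \<phi>, y'). (x, arr_comp D \<psi> \<phi>, z)),
         obj_act = (\<lambda>g. \<lambda>(K, a)\<in>Ob. (K, snd (V K) g a)),
         arr_act = (\<lambda>g. \<lambda>((K, a), \<phi>, (L, b))\<in>Ar.
                      ((K, snd (V K) g a), \<phi>, (L, snd (V L) g b)))\<rparr>)"

text \<open>For \<open>\<phi> : L \<rightarrow> K\<close>, \<open>x \<mapsto> gxg\<^sup>-\<^sup>1\<close>, the elements of \<open>G\<close> inducing \<open>\<phi>\<close> form the coset \<open>g C\<^sub>G(L)\<close>,
  and \<open>h C\<^sub>G(K) \<cdot> g C\<^sub>G(L) = hg C\<^sub>G(L)\<close>. The following product of sets is therefore the \<open>G\<close>-map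
  \<open>G/C\<^sub>G(K) \<rightarrow> G/C\<^sub>G(L)\<close> determined by \<open>C\<^sub>G(K) \<mapsto> g C\<^sub>G(L)\<close>; see \<open>centralizer_map_coset\<close>.\<close>

definition centralizer_map ::
    "('g, 'k) monoid_scheme \<Rightarrow> 'g set \<times> 'g set \<times> ('g \<Rightarrow> 'g) \<Rightarrow> 'g set \<Rightarrow> 'g set"
  where "centralizer_map G =
    (\<lambda>(L, K, \<phi>) a. a <#>\<^bsub>G\<^esub> {g \<in> carrier G. conj_hom G L g = \<phi>})"

lemma conj_hom_eq_iff:
  fixes G (structure)
  assumes "group G" and "L \<subseteq> carrier G" and g: "g \<in> carrier G"
  shows "{x \<in> carrier G. conj_hom G L x = conj_hom G L g} = g <#\<^bsub>G\<^esub> centralizer G L"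
proof -
  interpret group G by fact
  have eq: "(x \<otimes> l \<otimes> inv x = g \<otimes> l \<otimes> inv g) \<longleftrightarrow> (inv g \<otimes> x) \<otimes> l = l \<otimes> (inv g \<otimes> x)"
    if x: "x \<in> carrier G" and l: "l \<in> carrier G" for x l
  proof -
    have "(x \<otimes> l \<otimes> inv x = g \<otimes> l \<otimes> inv g) \<longleftrightarrow> x \<otimes> l = g \<otimes> l \<otimes> inv g \<otimes> x"
      using x l g by (simp add: inv_solve_right')
    also have "\<dots> \<longleftrightarrow> x \<otimes> l = g \<otimes> (l \<otimes> (inv g \<otimes> x))"
      using x l g by (simp add: m_assoc)
    also have "\<dots> \<longleftrightarrow> inv g \<otimes> (x \<otimes> l) = l \<otimes> (inv g \<otimes> x)"
      using x l g by (simp add: inv_solve_left')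
    finally show ?thesis
      using x l g by (simp add: m_assoc)
  qed
  show ?thesis
  proof (intro Set.set_eqI iffI)
    fix x assume "x \<in> {x \<in> carrier G. conj_hom G L x = conj_hom G L g}"
    then have x: "x \<in> carrier G" and c: "conj_hom G L x = conj_hom G L g" by auto
    have "\<forall>l\<in>L. (inv g \<otimes> x) \<otimes> l = l \<otimes> (inv g \<otimes> x)"
    proof
      fix l assume l: "l \<in> L"
      from fun_cong[OF c, of l] l eq[OF x, of l] assms(2) show "(inv g \<otimes> x) \<otimes> l = l \<otimes> (inv g \<otimes> x)"
        by (auto simp: conj_hom_def)
    qed
    then have "inv g \<otimes> x \<in> centralizer G L" using x g by (simp add: centralizer_def)
    moreover have "x = g \<otimes> (inv g \<otimes> x)" using x g by (simp add: m_assoc [symmetric])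
    ultimately show "x \<in> g <# centralizer G L" unfolding l_coset_def by blast
  next
    fix x assume "x \<in> g <# centralizer G L"
    then obtain c where c: "c \<in> carrier G" "\<forall>l\<in>L. c \<otimes> l = l \<otimes> c" and x: "x = g \<otimes> c"
      by (auto simp: l_coset_def centralizer_def)
    have "inv g \<otimes> x = c" using g c x by (simp add: m_assoc [symmetric])
    then show "x \<in> {x \<in> carrier G. conj_hom G L x = conj_hom G L g}"
      using c x g eq[of x] assms(2) by (auto simp: conj_hom_def fun_eq_iff)
  qed
qed

lemma subgroup_centralizer:
  fixes G (structure)
  assumes "group G" and "L \<subseteq> carrier G"
  shows "subgroup (centralizer G L) G"
proof -
  interpret group G by fact
  show ?thesis
  proof (rule subgroupI)
    show "centralizer G L \<noteq> {}" using assms(2) by (auto simp: centralizer_def intro!: exI[of _ \<one>])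
  next
    fix a assume "a \<in> centralizer G L"
    then have a: "a \<in> carrier G" and c: "a \<otimes> l = l \<otimes> a" if "l \<in> L" for l
      using that by (auto simp: centralizer_def)
    have a: "a \<in> carrier G" using \<open>a \<in> centralizer G L\<close> by (simp add: centralizer_def)
    have "inv a \<otimes> l = l \<otimes> inv a" if "l \<in> L" for l
    proof -
      have l: "l \<in> carrier G" using that assms(2) by auto
      have "inv a \<otimes> l \<otimes> a = inv a \<otimes> (a \<otimes> l)" using a l c[OF that] by (simp add: m_assoc)
      also have "\<dots> = l" using a l by (simp add: m_assoc [symmetric])
      finally show ?thesis using a l by (simp add: inv_solve_right)
    qed
    then show "inv a \<in> centralizer G L"
      using a by (simp add: centralizer_def)
  next
    fix a b assume "a \<in> centralizer G L" "b \<in> centralizer G L"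
    then have ab: "a \<in> carrier G" "b \<in> carrier G" and c: "\<And>l. l \<in> L \<Longrightarrow> a \<otimes> l = l \<otimes> a" "\<And>l. l \<in> L \<Longrightarrow> b \<otimes> l = l \<otimes> b"
      by (auto simp: centralizer_def)
    have "a \<otimes> b \<otimes> l = l \<otimes> (a \<otimes> b)" if "l \<in> L" for l
    proof -
      have l: "l \<in> carrier G" using that assms(2) by auto
      have "a \<otimes> b \<otimes> l = (a \<otimes> l) \<otimes> b" using ab l c(2)[OF that] by (simp add: m_assoc)
      then show ?thesis using ab l c(1)[OF that] by (simp add: m_assoc)
    qed
    then show "a \<otimes> b \<in> centralizer G L"
      using ab by (simp add: centralizer_def)
  qed (auto simp: centralizer_def)
qed

lemma centralizer_map_coset:
  fixes G (structure)
  assumes "group G" and "L \<subseteq> carrier G" and "K \<subseteq> carrier G"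
    and g: "g \<in> carrier G" and h: "h \<in> carrier G" and LK: "conj_hom G L g ` L \<subseteq> K"
  shows "centralizer_map G (L, K, conj_hom G L g) (h <#\<^bsub>G\<^esub> centralizer G K)
    = (h \<otimes>\<^bsub>G\<^esub> g) <#\<^bsub>G\<^esub> centralizer G L"
proof -
  interpret group G by fact
  have *: "inv g \<otimes> (c \<otimes> g) \<otimes> d \<in> centralizer G L"
    if c: "c \<in> centralizer G K" and d: "d \<in> centralizer G L" for c d
  proof -
    have "inv g \<otimes> (c \<otimes> g) \<in> centralizer G L"
    proof -
      have cc: "c \<in> carrier G" using c by (simp add: centralizer_def)
      have "(inv g \<otimes> (c \<otimes> g)) \<otimes> l = l \<otimes> (inv g \<otimes> (c \<otimes> g))" if l: "l \<in> L" for l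
      proof -
        have lc: "l \<in> carrier G" using l assms(2) by auto
        have "g \<otimes> l \<otimes> inv g \<in> K" using LK l by (auto simp: conj_hom_def)
        then have k: "c \<otimes> (g \<otimes> l \<otimes> inv g) = (g \<otimes> l \<otimes> inv g) \<otimes> c" using c by (auto simp: centralizer_def)
        have "(inv g \<otimes> (c \<otimes> g)) \<otimes> l = inv g \<otimes> (c \<otimes> (g \<otimes> l \<otimes> inv g)) \<otimes> g"
          using cc lc g by (simp add: m_assoc)
        also have "\<dots> = l \<otimes> (inv g \<otimes> (c \<otimes> g))"
          unfolding k using cc lc g by (simp add: m_assoc [symmetric])
        finally show ?thesis .
      qed
      then show ?thesis using cc g by (simp add: centralizer_def)
    qed
    with d show ?thesis
      using subgroup.m_closed[OF subgroup_centralizer[OF assms(1,2)]] by blast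
  qed
  have "(h <# centralizer G K) <#> (g <# centralizer G L) = (h \<otimes> g) <# centralizer G L"
  proof (intro Set.set_eqI iffI)
    fix x assume "x \<in> (h <# centralizer G K) <#> (g <# centralizer G L)"
    then obtain c d where c: "c \<in> centralizer G K" and d: "d \<in> centralizer G L"
      and x: "x = (h \<otimes> c) \<otimes> (g \<otimes> d)"
      by (auto simp: set_mult_def l_coset_def)
    have "c \<in> carrier G" "d \<in> carrier G" using c d by (auto simp: centralizer_def)
    then have "x = h \<otimes> (g \<otimes> inv g) \<otimes> (c \<otimes> (g \<otimes> d))"
      using g h by (simp add: x m_assoc)
    also have "\<dots> = (h \<otimes> g) \<otimes> (inv g \<otimes> (c \<otimes> g) \<otimes> d)"
      using g h \<open>c \<in> carrier G\<close> \<open>d \<in> carrier G\<close> by (simp only: m_assoc m_closed inv_closed)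
    finally have "x = (h \<otimes> g) \<otimes> (inv g \<otimes> (c \<otimes> g) \<otimes> d)" .
    with *[OF c d] show "x \<in> (h \<otimes> g) <# centralizer G L"
      unfolding l_coset_def by blast
  next
    fix x assume "x \<in> (h \<otimes> g) <# centralizer G L"
    then obtain d where d: "d \<in> centralizer G L" and x: "x = (h \<otimes> g) \<otimes> d"
      by (auto simp: l_coset_def)
    have 1: "\<one> \<in> centralizer G K" using assms(3) by (auto simp: centralizer_def)
    have "d \<in> carrier G" using d by (simp add: centralizer_def)
    then have "x = (h \<otimes> \<one>) \<otimes> (g \<otimes> d)" using g h by (simp add: x m_assoc)
    then show "x \<in> (h <# centralizer G K) <#> (g <# centralizer G L)"
      using 1 d unfolding set_mult_def l_coset_def by blast
  qed
  then show ?thesis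
    by (simp add: centralizer_map_def conj_hom_eq_iff[OF assms(1,2) g])
qed

definition EA ::
    "('g, 'k) monoid_scheme \<Rightarrow> 'g set set
      \<Rightarrow> ('g set \<times> 'g set,
          ('g set \<times> 'g set) \<times> ('g set \<times> 'g set \<times> ('g \<Rightarrow> 'g)) \<times> ('g set \<times> 'g set), 'g) gcategory"
  where "EA G C =
    grothendieck (op_category (fusion_category G C))
      (\<lambda>K. coset_gset G (centralizer G K)) (centralizer_map G)"


text \<open>\<open>E\<A>\<^sub>C\<close> is a finite category with a \<open>G\<close>-action.\<close>

lemma group_action_restrictI:
  assumes "group G"
    and closed: "\<And>g x. \<lbrakk>g \<in> carrier G; x \<in> E\<rbrakk> \<Longrightarrow> f g x \<in> E"
    and one: "\<And>x. x \<in> E \<Longrightarrow> f \<one>\<^bsub>G\<^esub> x = x"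
    and mult: "\<And>g h x. \<lbrakk>g \<in> carrier G; h \<in> carrier G; x \<in> E\<rbrakk> \<Longrightarrow> f (g \<otimes>\<^bsub>G\<^esub> h) x = f g (f h x)"
  shows "group_action G E (\<lambda>g. restrict (f g) E)"
proof -
  interpret group G by fact
  have inv: "f g (f (inv\<^bsub>G\<^esub> g) x) = x" "f (inv\<^bsub>G\<^esub> g) (f g x) = x"
    if "g \<in> carrier G" "x \<in> E" for g x
    using that mult[of g "inv\<^bsub>G\<^esub> g" x] mult[of "inv\<^bsub>G\<^esub> g" g x] one by auto
  have bij: "bij_betw (restrict (f g) E) E E" if g: "g \<in> carrier G" for g
    by (rule bij_betwI[where g = "f (inv\<^bsub>G\<^esub> g)"]) (use g closed inv in auto)
  have "(\<lambda>g. restrict (f g) E) \<in> hom G (BijGroup E)"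
  proof (rule homI)
    fix g assume "g \<in> carrier G"
    then show "restrict (f g) E \<in> carrier (BijGroup E)"
      using bij by (simp add: BijGroup_def Bij_def)
  next
    fix g h assume "g \<in> carrier G" "h \<in> carrier G"
    then show "restrict (f (g \<otimes>\<^bsub>G\<^esub> h)) E = restrict (f g) E \<otimes>\<^bsub>BijGroup E\<^esub> restrict (f h) E"
      using bij closed mult by (auto simp: BijGroup_def Bij_def compose_def fun_eq_iff)
  qed
  then show ?thesis
    by (simp add: group_action_def group_hom_def group_hom_axioms_def assms(1) group_BijGroup)
qed

lemma finite_gcategory_grothendieck:
  fixes D :: "('o, 'm) category" and V :: "'o \<Rightarrow> ('g, 'x) gset"
  assumes "group G" and "finite_category D"
    and V: "\<And>K. K \<in> obj D \<Longrightarrow> finite_gset G (V K)"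
    and v: "\<And>\<phi> a. \<lbrakk>\<phi> \<in> arr D; a \<in> fst (V (src D \<phi>))\<rbrakk> \<Longrightarrow> v \<phi> a \<in> fst (V (tgt D \<phi>))"
    and v_act: "\<And>\<phi> g a. \<lbrakk>\<phi> \<in> arr D; g \<in> carrier G; a \<in> fst (V (src D \<phi>))\<rbrakk>
      \<Longrightarrow> v \<phi> (snd (V (src D \<phi>)) g a) = snd (V (tgt D \<phi>)) g (v \<phi> a)"
    and v_idn: "\<And>K a. \<lbrakk>K \<in> obj D; a \<in> fst (V K)\<rbrakk> \<Longrightarrow> v (idn D K) a = a"
    and v_comp: "\<And>\<phi> \<psi> a. \<lbrakk>\<phi> \<in> arr D; \<psi> \<in> arr D; tgt D \<phi> = src D \<psi>; a \<in> fst (V (src D \<phi>))\<rbrakk>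
      \<Longrightarrow> v (arr_comp D \<psi> \<phi>) a = v \<psi> (v \<phi> a)"
  shows "finite_gcategory G (grothendieck D V v)"
proof -
  interpret group G by fact
  interpret D: finite_category D by fact
  define Ob where "Ob = (SIGMA K:obj D. fst (V K))"
  define Ar where "Ar = {((K, a), \<phi>, (L, b)) |K a \<phi> L b.
    (K, a) \<in> Ob \<and> (L, b) \<in> Ob \<and> \<phi> \<in> arr D \<and> src D \<phi> = K \<and> tgt D \<phi> = L \<and> v \<phi> a = b}"
  note eqs = grothendieck_def Let_def Ob_def[symmetric] Ar_def[symmetric]
  have act: "group_action G (fst (V K)) (snd (V K))" if "K \<in> obj D" for K
    using V[OF that] by (simp add: finite_gset_def)
  have closed: "snd (V K) g a \<in> fst (V K)" if "K \<in> obj D" "g \<in> carrier G" "a \<in> fst (V K)" for K g a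
    using group_action.element_image[OF act[OF that(1)] that(2,3)] by simp
  have one: "snd (V K) \<one>\<^bsub>G\<^esub> a = a" if "K \<in> obj D" "a \<in> fst (V K)" for K a
    using group_action.id_eq_one[OF act[OF that(1)]] that(2) by (metis restrict_apply')
  have mult: "snd (V K) (g \<otimes>\<^bsub>G\<^esub> h) a = snd (V K) g (snd (V K) h a)"
    if "K \<in> obj D" "g \<in> carrier G" "h \<in> carrier G" "a \<in> fst (V K)" for K g h a
    using group_action.composition_rule[OF act[OF that(1)] that(4,2,3)] .
  have finOb: "finite Ob"
    unfolding Ob_def using D.finite_obj V by (auto simp: finite_gset_def)
  have "Ar \<subseteq> Ob \<times> arr D \<times> Ob" by (auto simp: Ar_def)
  then have finAr: "finite Ar"
    by (rule finite_subset) (simp add: finOb D.finite_arr)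
  have actOb: "group_action G Ob (\<lambda>g. \<lambda>(K, a)\<in>Ob. (K, snd (V K) g a))"
    by (rule group_action_restrictI[OF assms(1)]) (auto simp: Ob_def closed one mult)
  have actAr: "group_action G Ar (\<lambda>g. \<lambda>((K, a), \<phi>, (L, b))\<in>Ar.
       ((K, snd (V K) g a), \<phi>, (L, snd (V L) g b)))"
    by (rule group_action_restrictI[OF assms(1)]) (auto simp: Ar_def Ob_def closed one mult v_act v)
  have Ar_iff: "((K, a), \<phi>, (L, b)) \<in> Ar \<longleftrightarrow> K \<in> obj D \<and> a \<in> fst (V K) \<and> L \<in> obj D \<and> b \<in> fst (V L)
    \<and> \<phi> \<in> arr D \<and> src D \<phi> = K \<and> tgt D \<phi> = L \<and> v \<phi> a = b" for K a \<phi> L b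
    by (auto simp: Ar_def Ob_def)
  have Ob_iff: "(K, a) \<in> Ob \<longleftrightarrow> K \<in> obj D \<and> a \<in> fst (V K)" for K a
    by (auto simp: Ob_def)
  have ArE: thesis if "m \<in> Ar" "\<And>K a \<phi> L b. \<lbrakk>m = ((K, a), \<phi>, (L, b)); K \<in> obj D; a \<in> fst (V K); L \<in> obj D; b \<in> fst (V L);
      \<phi> \<in> arr D; src D \<phi> = K; tgt D \<phi> = L; v \<phi> a = b\<rbrakk> \<Longrightarrow> thesis" for m thesis
    using that by (auto simp: Ar_def Ob_def)
  have "finite_category (grothendieck D V v)"
  proof (unfold_locales, goal_cases)
    case 1 show ?case by (simp add: eqs finOb)
  next
    case 2 have "arr (grothendieck D V v) = Ar" by (simp add: grothendieck_def Let_def Ar_def Ob_def)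
    then show ?case by (simp add: finAr)
  qed (auto simp: eqs Ar_iff Ob_iff v_idn v_comp D.comp_assoc D.comp_idn_left D.comp_idn_right
        D.src_idn D.tgt_idn D.idn_closed D.comp_closed D.src_comp D.tgt_comp elim!: ArE)
  then interpret finite_category "grothendieck D V v" .
  have objs: "obj (grothendieck D V v) = Ob"
    and arrs: "arr (grothendieck D V v) = Ar"
    and obj_acts: "obj_act (grothendieck D V v) = (\<lambda>g. \<lambda>(K, a)\<in>Ob. (K, snd (V K) g a))"
    and arr_acts: "arr_act (grothendieck D V v) = (\<lambda>g. \<lambda>((K, a), \<phi>, (L, b))\<in>Ar.
       ((K, snd (V K) g a), \<phi>, (L, snd (V L) g b)))"
    and srcs: "src (grothendieck D V v) = (\<lambda>(x, \<phi>, y). x)"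
    and tgts: "tgt (grothendieck D V v) = (\<lambda>(x, \<phi>, y). y)"
    and idns: "idn (grothendieck D V v) = (\<lambda>(K, a). ((K, a), idn D K, (K, a)))"
    and comps: "arr_comp (grothendieck D V v) = (\<lambda>(y, \<psi>, z) (x, \<phi>, y'). (x, arr_comp D \<psi> \<phi>, z))"
    by (simp_all add: grothendieck_def Let_def Ar_def Ob_def)
  show ?thesis
  proof (rule finite_gcategory.intro)
    show "finite_gcategory_axioms G (grothendieck D V v)"
    proof (rule finite_gcategory_axioms.intro, goal_cases)
      case 1 show ?case using actOb by (simp add: objs obj_acts)
    next
      case 2 show ?case using actAr by (simp add: arrs arr_acts)
    qed (auto simp: objs arrs obj_acts arr_acts srcs tgts idns comps Ar_iff Ob_iff v_idn v_comp v_act closed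
          D.src_idn D.tgt_idn D.idn_closed D.comp_closed D.src_comp D.tgt_comp elim!: ArE)
  qed fact
qed

lemma finite_category_fusion:
  assumes "group G" and "finite (carrier G)" and C: "\<And>H. H \<in> C \<Longrightarrow> subgroup H G"
  shows "finite_category (fusion_category G C)"
proof -
  interpret group G by fact
  have CP: "H \<subseteq> carrier G" if "H \<in> C" for H
    using subgroup.subset[OF C[OF that]] .
  have finC: "finite C"
    by (rule finite_subset[of _ "Pow (carrier G)"]) (use CP assms(2) in auto)
  have comp: "compose L (conj_hom G K h) (conj_hom G L g) = conj_hom G L (h \<otimes>\<^bsub>G\<^esub> g)"
    if "L \<in> C" "g \<in> carrier G" "h \<in> carrier G" "conj_hom G L g ` L \<subseteq> K" for L K g h
    using that CP[OF that(1)]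
    by (auto simp: compose_def conj_hom_def fun_eq_iff subset_iff image_iff m_assoc inv_mult_group)
  have idn: "(\<lambda>x\<in>L. x) = conj_hom G L \<one>\<^bsub>G\<^esub>" if "L \<in> C" for L
    using CP[OF that] by (auto simp: conj_hom_def fun_eq_iff)
  have assoc: "compose L \<chi> (compose L \<psi> \<phi>) = compose L (compose K \<chi> \<psi>) \<phi>" if "\<phi> ` L \<subseteq> K"
    for L K :: "'a set" and \<phi> \<psi> \<chi> :: "'a \<Rightarrow> 'a"
    using that by (auto simp: compose_def fun_eq_iff)
  have "arr (fusion_category G C) \<subseteq> (\<lambda>(L, K, g). (L, K, conj_hom G L g)) ` (C \<times> C \<times> carrier G)"
    by (auto simp: fusion_category_def image_iff)
  then have fin: "finite (arr (fusion_category G C))"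
    by (rule finite_subset) (simp add: finC assms(2))
  show ?thesis
  proof (unfold_locales, goal_cases)
    case 1 show ?case by (simp add: fusion_category_def finC)
  next
    case 2 show ?case by (rule fin)
  next
    case (5 L)
    then have "L \<in> C" by (simp add: fusion_category_def)
    moreover have "conj_hom G L \<one>\<^bsub>G\<^esub> ` L \<subseteq> L"
      using idn[OF \<open>L \<in> C\<close>, symmetric] by simp
    ultimately show ?case
      by (auto simp: fusion_category_def idn intro!: exI[of _ "\<one>\<^bsub>G\<^esub>"])
  next
    case (8 m n)
    then obtain L K g M h where m: "m = (L, K, conj_hom G L g)" "L \<in> C" "K \<in> C" "g \<in> carrier G" "conj_hom G L g ` L \<subseteq> K"
      and n: "n = (K, M, conj_hom G K h)" "M \<in> C" "h \<in> carrier G" "conj_hom G K h ` K \<subseteq> M"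
      by (auto simp: fusion_category_def)
    have "conj_hom G L (h \<otimes>\<^bsub>G\<^esub> g) ` L \<subseteq> M"
      using m n by (auto simp: comp[symmetric] compose_def)
    then show ?case
      using m n by (auto simp: fusion_category_def comp intro!: exI[of _ "h \<otimes>\<^bsub>G\<^esub> g"])
  next
    case (13 l m n)
    then show ?case by (auto simp: fusion_category_def intro!: assoc)
  qed (auto simp: fusion_category_def compose_def fun_eq_iff image_subset_iff, auto simp: conj_hom_def image_subset_iff)
qed

lemma finite_category_op:
  assumes "finite_category D"
  shows "finite_category (op_category D)"
proof -
  interpret finite_category D by fact
  show ?thesis
    by unfold_locales (auto simp: op_category_def finite_obj finite_arr src_closed tgt_closed
      idn_closed src_idn tgt_idn comp_closed src_comp tgt_comp comp_idn_left comp_idn_right comp_assoc)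
qed

lemma finite_gset_coset:
  assumes "group G" and "finite (carrier G)" and H: "subgroup H G"
  shows "finite_gset G (coset_gset G H)"
proof -
  interpret group G by fact
  have "finite (lcosets\<^bsub>G\<^esub> H)" using assms(2) by (simp add: LCOSETS_def)
  moreover have "group_action G (lcosets\<^bsub>G\<^esub> H) (\<lambda>g. restrict ((<#\<^bsub>G\<^esub>) g) (lcosets\<^bsub>G\<^esub> H))"
  proof (rule group_action_restrictI[OF assms(1)])
    fix g x assume "g \<in> carrier G" "x \<in> lcosets\<^bsub>G\<^esub> H"
    then show "g <#\<^bsub>G\<^esub> x \<in> lcosets\<^bsub>G\<^esub> H"
      using subgroup.subset[OF H] by (force simp: LCOSETS_def lcos_m_assoc)
  next
    fix x assume "x \<in> lcosets\<^bsub>G\<^esub> H"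
    then show "\<one>\<^bsub>G\<^esub> <#\<^bsub>G\<^esub> x = x"
      using subgroup.subset[OF H] by (auto simp: LCOSETS_def lcos_m_assoc)
  next
    fix g h x assume "g \<in> carrier G" "h \<in> carrier G" "x \<in> lcosets\<^bsub>G\<^esub> H"
    then show "g \<otimes>\<^bsub>G\<^esub> h <#\<^bsub>G\<^esub> x = g <#\<^bsub>G\<^esub> (h <#\<^bsub>G\<^esub> x)"
      using subgroup.subset[OF H] by (auto simp: LCOSETS_def lcos_m_assoc m_assoc)
  qed
  ultimately show ?thesis by (simp add: finite_gset_def coset_gset_def)
qed

lemma finite_gcategory_EA:
  assumes "group G" and "finite (carrier G)" and C: "\<And>H. H \<in> C \<Longrightarrow> subgroup H G"
  shows "finite_gcategory G (EA G C)"
proof -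
  interpret group G by fact
  let ?F = "op_category (fusion_category G C)"
  have CP: "H \<subseteq> carrier G" if "H \<in> C" for H
    using subgroup.subset[OF C[OF that]] .
  have arrE: thesis if "\<phi> \<in> arr ?F"
      "\<And>L K g. \<lbrakk>\<phi> = (L, K, conj_hom G L g); L \<in> C; K \<in> C; g \<in> carrier G; conj_hom G L g ` L \<subseteq> K;
          src ?F \<phi> = K; tgt ?F \<phi> = L\<rbrakk> \<Longrightarrow> thesis" for \<phi> thesis
    using that by (auto simp: op_category_def fusion_category_def)
  have cosE: thesis if "a \<in> fst (coset_gset G H)"
      "\<And>h. \<lbrakk>a = h <#\<^bsub>G\<^esub> H; h \<in> carrier G\<rbrakk> \<Longrightarrow> thesis" for a H thesis
    using that by (auto simp: coset_gset_def LCOSETS_def)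
  have cosI: "h <#\<^bsub>G\<^esub> H \<in> fst (coset_gset G H)" if "h \<in> carrier G" for h H
    using that by (auto simp: coset_gset_def LCOSETS_def)
  have act: "snd (coset_gset G (centralizer G H)) g (h <#\<^bsub>G\<^esub> centralizer G H) = (g \<otimes>\<^bsub>G\<^esub> h) <#\<^bsub>G\<^esub> centralizer G H"
    if "h \<in> carrier G" "g \<in> carrier G" for g h H
  proof -
    have "centralizer G H \<subseteq> carrier G" by (auto simp: centralizer_def)
    then show ?thesis using that cosI[of h "centralizer G H"] by (auto simp: coset_gset_def lcos_m_assoc)
  qed
  have map: "centralizer_map G (L, K, conj_hom G L g) (h <#\<^bsub>G\<^esub> centralizer G K) = (h \<otimes>\<^bsub>G\<^esub> g) <#\<^bsub>G\<^esub> centralizer G L"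
    if "L \<in> C" "K \<in> C" "g \<in> carrier G" "h \<in> carrier G" "conj_hom G L g ` L \<subseteq> K" for L K g h
    using centralizer_map_coset[OF assms(1) CP CP] that by blast
  have F: "finite_category ?F"
    by (intro finite_category_op finite_category_fusion assms)
  show ?thesis
    unfolding EA_def
  proof (rule finite_gcategory_grothendieck[OF assms(1) F], goal_cases)
    case (1 H)
    then have "H \<in> C" by (simp add: op_category_def fusion_category_def)
    then show ?case
      by (intro finite_gset_coset assms subgroup_centralizer CP)
  next
    case (2 \<phi> a)
    then show ?case by (elim arrE cosE) (auto simp: map intro!: cosI)
  next
    case (3 \<phi> g a)
    then show ?case by (elim arrE cosE) (auto simp: map act m_assoc)
  next
    case (4 K a)
    then have K: "K \<in> C" by (simp add: op_category_def fusion_category_def)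
    have idn: "(\<lambda>x\<in>K. x) = conj_hom G K \<one>\<^bsub>G\<^esub>"
      using CP[OF K] by (auto simp: conj_hom_def fun_eq_iff)
    have "conj_hom G K \<one>\<^bsub>G\<^esub> ` K \<subseteq> K" by (auto simp: idn[symmetric])
    with 4 K show ?case
      by (elim cosE) (simp add: op_category_def fusion_category_def idn map)
  next
    case (5 \<phi> \<psi> a)
    show ?case
      using 5(1,2)
    proof (elim arrE)
      fix L K g M N h
      assume \<phi>: "\<phi> = (L, K, conj_hom G L g)" "L \<in> C" "K \<in> C" "g \<in> carrier G" "conj_hom G L g ` L \<subseteq> K"
          "src ?F \<phi> = K" "tgt ?F \<phi> = L"
        and \<psi>: "\<psi> = (M, N, conj_hom G M h)" "M \<in> C" "N \<in> C" "h \<in> carrier G" "conj_hom G M h ` M \<subseteq> N"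
          "src ?F \<psi> = N" "tgt ?F \<psi> = M"
      have N: "N = L" using 5(3) \<phi> \<psi> by simp
      have comp: "compose M (conj_hom G L g) (conj_hom G M h) = conj_hom G M (g \<otimes>\<^bsub>G\<^esub> h)"
        using \<phi> \<psi> CP[of M] N
        by (auto simp: compose_def conj_hom_def fun_eq_iff subset_iff image_iff m_assoc inv_mult_group)
      have "conj_hom G M (g \<otimes>\<^bsub>G\<^esub> h) ` M \<subseteq> K"
        unfolding comp[symmetric] compose_def using \<phi>(5) \<psi>(5) N by (simp add: image_subset_iff)
      moreover obtain k where "k \<in> carrier G" "a = k <#\<^bsub>G\<^esub> centralizer G K"
        using 5(4) \<phi>(6) by (auto elim: cosE)
      ultimately show ?case
        using \<phi> \<psi> N by (simp add: op_category_def fusion_category_def comp map m_assoc)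
    qed
  qed
qed


section \<open>M\<ouml>bius functions of finite posets\<close>

function mobius :: "'a::order set \<Rightarrow> 'a \<Rightarrow> 'a \<Rightarrow> int"
  where "mobius P x y =
    (if finite P \<and> x \<in> P \<and> y \<in> P \<and> x \<le> y
     then if x = y then 1 else - (\<Sum>z\<in>{z \<in> P. x \<le> z \<and> z < y}. mobius P x z)
     else 0)"
  by pat_completeness auto
termination
proof (relation "measure (\<lambda>(P, x, y). card {z \<in> P. z < y})")
  fix P :: "'a set" and x y z
  assume "finite P \<and> x \<in> P \<and> y \<in> P \<and> x \<le> y" and "z \<in> {z \<in> P. x \<le> z \<and> z < y}"
  then have "{u \<in> P. u < z} \<subset> {u \<in> P. u < y}" and "finite {u \<in> P. u < y}"
    by (auto intro: less_trans)
  then show "((P, x, z), (P, x, y)) \<in> measure (\<lambda>(P, x, y). card {z \<in> P. z < y})"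
    by (simp add: psubset_card_mono)
qed simp

declare mobius.simps [simp del]

text \<open>In the order on \<^typ>\<open>'a option\<close>, \<^const>\<open>None\<close> is a new minimum.\<close>

definition add_minimum :: "'a set \<Rightarrow> 'a option set"
  where "add_minimum C = insert None (Some ` C)"

end

(* Sending a pair (K, g C_G(K)) to gKg^-1 identifies EA_C, up to equivalence, with the opposite of the
   poset C: there is at most one arrow (K, a) -> (L, b), and it exists iff the subgroup of (L, b) is
   contained in that of (K, a). Hence the stabilizer of a simplex is the centralizer of the subgroup H
   of its initial object, and [D_n] is the sum over H in C of a_n(H) [G/C_G(H)], where a_n(H) is the
   number of n-simplices starting at a fixed object over H. There are w(H) = |G : C_G(H)| objects over
   H, so the generating function A_H of a_n(H) satisfies
     A_H = 1 + t (sum_{K <= H} w(K) A_K - A_H).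
   At t = -1 this says that the numbers w(H) A_H(-1) satisfy the recursion of -mu(-infinity, H). *)

theory Submission
  imports Defs
begin

section \<open>The rational Burnside ring as a quotient vector space\<close>

text \<open>Distinct objects over the same subgroup are isomorphic, so chains can run back and forth
  between them: as soon as some w(H) > 1 there are non-degenerate simplices in every dimension, and
  the value at -1 needs a rational continuation. Collecting the terms with A_H in the recursion
  gives it the factor 1 + (1 - w(H)) t. At -1 this factor is w(H), which is nonzero, so no pole
  arises there; it is also the origin of the index in the denominators of the formula. The value
  must moreover not depend on the tensor that represents f, although representatives are determined
  only modulo \<open>burnside_relations\<close>. One denominator Q with Q(-1) nonzero reduces this
  to polynomials, whose values are finite linear combinations of their coefficients. The class of a
  G-set is expanded over its points, each weighted by the inverse size of its orbit. This avoids
  choosing orbit representatives or subgroups up to conjugacy, and it fits a sum over all H in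
  C.\<close>

lemma lookup_scale: "Poly_Mapping.lookup (scale c u) k = c * Poly_Mapping.lookup u k"
  by (simp add: Poly_Mapping.map.rep_eq when_def)

lemma module_scale: "Modules.module (scale :: rat \<Rightarrow> ('a \<Rightarrow>\<^sub>0 rat) \<Rightarrow> ('a \<Rightarrow>\<^sub>0 rat))"
  by unfold_locales
    (auto intro!: poly_mapping_eqI simp: lookup_scale lookup_add algebra_simps)

interpretation scale: Modules.module "scale :: rat \<Rightarrow> ('a \<Rightarrow>\<^sub>0 rat) \<Rightarrow> ('a \<Rightarrow>\<^sub>0 rat)"
  by (rule module_scale)

lemma subspace_burnside_relations: "scale.subspace (burnside_relations G)"
  unfolding burnside_relations_def by (rule scale.subspace_span)

text \<open>Defined for every finitely supported function, so that the operations of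
  \<open>burnside_ring\<close> can be computed on representatives; membership in the carrier is the
  separate condition on \<open>keys\<close>.\<close>

definition quot_class ::
    "('g, 'k) monoid_scheme \<Rightarrow> ('g gset_class \<Rightarrow>\<^sub>0 rat) \<Rightarrow> ('g gset_class \<Rightarrow>\<^sub>0 rat) set"
  where "quot_class G u = burnside_relations G +>\<^bsub>free_burnside G\<^esub> u"

lemma quot_class_eq: "quot_class G u = {r + u |r. r \<in> burnside_relations G}"
  by (auto simp: quot_class_def a_r_coset_def' free_burnside_def)

lemma quot_class_eq_iff: "quot_class G u = quot_class G v \<longleftrightarrow> u - v \<in> burnside_relations G"
proof
  assume eq: "quot_class G u = quot_class G v"
  have "u \<in> quot_class G u"
    using scale.subspace_0[OF subspace_burnside_relations] by (force simp: quot_class_eq)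
  then show "u - v \<in> burnside_relations G" unfolding eq by (auto simp: quot_class_eq)
next
  have sub: "quot_class G u \<subseteq> quot_class G v" if "u - v \<in> burnside_relations G" for u v
  proof
    fix x assume "x \<in> quot_class G u"
    then obtain r where r: "r \<in> burnside_relations G" and x: "x = r + u" by (auto simp: quot_class_eq)
    have "x = (r + (u - v)) + v" by (simp add: x)
    with r that scale.subspace_add[OF subspace_burnside_relations]
    show "x \<in> quot_class G v" unfolding quot_class_eq by blast
  qed
  assume uv: "u - v \<in> burnside_relations G"
  have "v - u \<in> burnside_relations G"
    using scale.subspace_neg[OF subspace_burnside_relations uv] by simp
  then show "quot_class G u = quot_class G v" using uv sub by blast
qed

lemma zero_burnside: "\<zero>\<^bsub>burnside_ring G\<^esub> = quot_class G 0"
  by (simp add: burnside_ring_def ring.defs module.defs FactRing_def quot_class_eq)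

lemma carrier_burnside:
  "carrier (burnside_ring G) = quot_class G ` {u. Poly_Mapping.keys u \<subseteq> iso_classes G}"
  by (auto simp: burnside_ring_def ring.defs module.defs FactRing_def A_RCOSETS_def' quot_class_def
      free_burnside_def a_r_coset_def')

lemma add_burnside: "quot_class G u \<oplus>\<^bsub>burnside_ring G\<^esub> quot_class G v = quot_class G (u + v)"
proof -
  have "quot_class G u \<oplus>\<^bsub>burnside_ring G\<^esub> quot_class G v =
      {a + b |a b. a \<in> quot_class G u \<and> b \<in> quot_class G v}"
    by (auto simp: burnside_ring_def ring.defs module.defs FactRing_def set_add_def' free_burnside_def)
  also have "\<dots> = quot_class G (u + v)"
  proof safe
    fix a b assume "a \<in> quot_class G u" "b \<in> quot_class G v"
    then obtain r s where rs: "r \<in> burnside_relations G" "s \<in> burnside_relations G"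
      and ab: "a = r + u" "b = s + v" by (auto simp: quot_class_eq)
    have "a + b = (r + s) + (u + v)" by (simp add: ab)
    then show "a + b \<in> quot_class G (u + v)"
      using rs scale.subspace_add[OF subspace_burnside_relations] unfolding quot_class_eq by blast
  next
    fix x assume "x \<in> quot_class G (u + v)"
    then obtain r where r: "r \<in> burnside_relations G" and x: "x = (r + u) + (0 + v)"
      by (auto simp: quot_class_eq add.assoc)
    have "0 + v \<in> quot_class G v"
      unfolding quot_class_eq using scale.subspace_0[OF subspace_burnside_relations] by blast
    moreover have "r + u \<in> quot_class G u" using r by (auto simp: quot_class_eq)
    ultimately show "\<exists>a b. x = a + b \<and> a \<in> quot_class G u \<and> b \<in> quot_class G v"
      using x by blast
  qed
  finally show ?thesis .
qed

text \<open>All cosets in the union that defines the scalar multiplication coincide, because the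
  relations are closed under scaling. This includes c = 0, where the pointwise multiples of a coset
  would be just {0}.\<close>

lemma smult_burnside: "c \<odot>\<^bsub>burnside_ring G\<^esub> quot_class G u = quot_class G (scale c u)"
proof -
  have "c \<odot>\<^bsub>burnside_ring G\<^esub> quot_class G u =
      (\<Union>r\<in>burnside_relations G. quot_class G (scale c (r + u)))"
    by (auto simp: burnside_ring_def ring.defs module.defs quot_class_def[symmetric] quot_class_eq)
  also have "\<dots> = (\<Union>r\<in>burnside_relations G. quot_class G (scale c u))"
  proof (rule SUP_cong[OF refl])
    fix r assume "r \<in> burnside_relations G"
    then have "scale c r \<in> burnside_relations G"
      by (rule scale.subspace_scale[OF subspace_burnside_relations])
    then show "quot_class G (scale c (r + u)) = quot_class G (scale c u)"
      by (simp add: quot_class_eq_iff scale.scale_right_distrib)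
  qed
  also have "\<dots> = quot_class G (scale c u)"
    using scale.subspace_0[OF subspace_burnside_relations] by auto
  finally show ?thesis .
qed

lemma abelian_monoid_burnside: "abelian_monoid (burnside_ring G)"
proof (rule abelian_monoidI)
  fix x y
  assume "x \<in> carrier (burnside_ring G)" "y \<in> carrier (burnside_ring G)"
  then obtain u v where uv: "x = quot_class G u" "y = quot_class G v"
    and "Poly_Mapping.keys u \<subseteq> iso_classes G" "Poly_Mapping.keys v \<subseteq> iso_classes G"
    by (auto simp: carrier_burnside)
  then have "Poly_Mapping.keys (u + v) \<subseteq> iso_classes G"
    using Poly_Mapping.keys_add[of u v] by blast
  then show "x \<oplus>\<^bsub>burnside_ring G\<^esub> y \<in> carrier (burnside_ring G)"
    by (simp add: uv carrier_burnside add_burnside)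
qed (auto simp: carrier_burnside add_burnside zero_burnside ac_simps)

lemma finsum_burnside:
  assumes "\<And>i. i \<in> I \<Longrightarrow> Poly_Mapping.keys (u i) \<subseteq> iso_classes G"
  shows "(\<Oplus>\<^bsub>burnside_ring G\<^esub> i\<in>I. quot_class G (u i)) = quot_class G (\<Sum>i\<in>I. u i)"
proof -
  interpret abelian_monoid "burnside_ring G" by (rule abelian_monoid_burnside)
  show ?thesis
    using assms
  proof (induction I rule: infinite_finite_induct)
    case (insert i I)
    then have "(\<lambda>i. quot_class G (u i)) \<in> insert i I \<rightarrow> carrier (burnside_ring G)"
      by (auto simp: carrier_burnside)
    then have "(\<Oplus>\<^bsub>burnside_ring G\<^esub> i\<in>insert i I. quot_class G (u i)) =
        quot_class G (u i) \<oplus>\<^bsub>burnside_ring G\<^esub> (\<Oplus>\<^bsub>burnside_ring G\<^esub> i\<in>I. quot_class G (u i))"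
      by (intro finsum_insert insert) auto
    then show ?case using insert by (simp add: add_burnside)
  qed (simp_all add: zero_burnside)
qed

lemma keys_scale_subset: "Poly_Mapping.keys u \<subseteq> A \<Longrightarrow> Poly_Mapping.keys (scale c u) \<subseteq> A"
  by (auto simp: in_keys_iff lookup_scale subset_iff)

lemma finsum_smult_burnside:
  assumes "\<And>i. i \<in> I \<Longrightarrow> Poly_Mapping.keys (u i) \<subseteq> iso_classes G"
    and "\<And>i. i \<in> I \<Longrightarrow> w i = quot_class G (u i)"
  shows "(\<Oplus>\<^bsub>burnside_ring G\<^esub> i\<in>I. c i \<odot>\<^bsub>burnside_ring G\<^esub> w i) =
    quot_class G (\<Sum>i\<in>I. scale (c i) (u i))"
proof -
  interpret abelian_monoid "burnside_ring G" by (rule abelian_monoid_burnside)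
  have "(\<Oplus>\<^bsub>burnside_ring G\<^esub> i\<in>I. c i \<odot>\<^bsub>burnside_ring G\<^esub> w i) =
      (\<Oplus>\<^bsub>burnside_ring G\<^esub> i\<in>I. quot_class G (scale (c i) (u i)))"
    using assms by (intro finsum_cong') (auto simp: smult_burnside carrier_burnside keys_scale_subset)
  also have "\<dots> = quot_class G (\<Sum>i\<in>I. scale (c i) (u i))"
    by (intro finsum_burnside keys_scale_subset assms)
  finally show ?thesis .
qed


section \<open>Values of rational functions at \<open>-1\<close>\<close>

text \<open>\<open>ratfun_laurent\<close> looks at the reduced fraction p'/q', but p' q = p q'
  survives in the field of Laurent series, so every fraction gives the same expansion.\<close>

lemma ratfun_laurent_Fract:
  assumes "q \<noteq> 0"
  shows "ratfun_laurent (Fract p q) = fps_to_fls (fps_of_poly p) / fps_to_fls (fps_of_poly q)"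
proof -
  obtain p' q' where pq': "quot_of_fract (Fract p q) = (p', q')" by fastforce
  then have "q' \<noteq> 0" using snd_quot_of_fract_nonzero[of "Fract p q"] by simp
  moreover have "Fract p' q' = Fract p q"
    using Fract_quot_of_fract[of "Fract p q"] pq' by simp
  ultimately have "p' * q = p * q'" using assms by (simp add: eq_fract)
  then have "fps_of_poly p' * fps_of_poly q = fps_of_poly p * fps_of_poly q'"
    by (simp flip: fps_of_poly_mult)
  then have "fps_to_fls (fps_of_poly p') * fps_to_fls (fps_of_poly q) =
      fps_to_fls (fps_of_poly p) * fps_to_fls (fps_of_poly q')"
    by (simp flip: fls_times_fps_to_fls)
  then show ?thesis
    using assms \<open>q' \<noteq> 0\<close> by (simp add: ratfun_laurent_def pq' frac_eq_eq)
qed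

text \<open>The reduced denominator q' cannot vanish at a: then p'(a) q(a) = p(a) q'(a) = 0 would
  make a also a root of p', against coprimality.\<close>

lemma ratfun_eval_Fract:
  assumes "poly q a \<noteq> 0"
  shows "ratfun_eval (Fract p q) a = poly p a / poly q a"
proof -
  have "q \<noteq> 0" using assms by auto
  obtain p' q' where pq': "quot_of_fract (Fract p q) = (p', q')" by fastforce
  then have "q' \<noteq> 0" and "coprime p' q'"
    using snd_quot_of_fract_nonzero[of "Fract p q"] coprime_quot_of_fract[of "Fract p q"] by simp_all
  moreover have "Fract p' q' = Fract p q"
    using Fract_quot_of_fract[of "Fract p q"] pq' by simp
  ultimately have "p' * q = p * q'" using \<open>q \<noteq> 0\<close> by (simp add: eq_fract)
  then have eq: "poly p' a * poly q a = poly p a * poly q' a"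
    by (simp flip: poly_mult)
  have "poly q' a \<noteq> 0"
  proof
    assume 0: "poly q' a = 0"
    with eq assms have "poly p' a = 0" by simp
    with 0 have "[:-a, 1:] dvd p'" "[:-a, 1:] dvd q'" by (simp_all add: poly_eq_0_iff_dvd)
    with \<open>coprime p' q'\<close> have "is_unit [:-a, 1:]" by (rule coprime_common_divisor)
    then show False by (simp add: is_unit_iff_degree)
  qed
  then show ?thesis using eq assms by (simp add: ratfun_eval_def pq' frac_eq_eq)
qed

lemma regular_at_minus_one_iff:
  "r \<in> regular_at_minus_one \<longleftrightarrow> (\<exists>p q. r = Fract p q \<and> poly q (- 1) \<noteq> 0)"
  by (auto simp: regular_at_minus_one_def poly_eq_0_iff_dvd)

text \<open>A single Q turns all expansions into polynomials at once, and as Q(-1) is nonzero the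
  values at -1 can be recovered by division.\<close>

lemma common_denominator:
  assumes "finite I" and "\<And>i. i \<in> I \<Longrightarrow> r i \<in> regular_at_minus_one"
  shows "\<exists>Q P. poly Q (- 1) \<noteq> 0 \<and>
    (\<forall>i\<in>I. fps_to_fls (fps_of_poly Q) * ratfun_laurent (r i) = fps_to_fls (fps_of_poly (P i)) \<and>
      poly (P i) (- 1) = poly Q (- 1) * ratfun_eval (r i) (- 1))"
  using assms
proof (induction I rule: finite_induct)
  case empty
  show ?case by (rule exI[of _ 1]) simp
next
  case (insert j I)
  then obtain Q P where Q: "poly Q (- 1) \<noteq> 0"
    and P: "\<And>i. i \<in> I \<Longrightarrow> fps_to_fls (fps_of_poly Q) * ratfun_laurent (r i) = fps_to_fls (fps_of_poly (P i))"
      "\<And>i. i \<in> I \<Longrightarrow> poly (P i) (- 1) = poly Q (- 1) * ratfun_eval (r i) (- 1)"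
    by auto
  obtain p q where r: "r j = Fract p q" and q: "poly q (- 1) \<noteq> 0"
    using insert.prems[of j] by (auto simp: regular_at_minus_one_iff)
  then have "q \<noteq> 0" by auto
  \<comment> \<open>With the new denominator q Q, the fraction p/q acquires the numerator Q p, and
    each old numerator is multiplied by q.\<close>
  define P' where "P' = (\<lambda>i. if i = j then Q * p else q * P i)"
  have "poly (q * Q) (- 1) \<noteq> 0" using q Q by simp
  moreover have "fps_to_fls (fps_of_poly (q * Q)) * ratfun_laurent (r i) = fps_to_fls (fps_of_poly (P' i)) \<and>
      poly (P' i) (- 1) = poly (q * Q) (- 1) * ratfun_eval (r i) (- 1)" if "i \<in> insert j I" for i
  proof (cases "i = j")
    case True
    then show ?thesis
      using q \<open>q \<noteq> 0\<close>
      by (simp add: P'_def r ratfun_laurent_Fract ratfun_eval_Fract fps_of_poly_mult fls_times_fps_to_fls)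
  next
    case False
    then show ?thesis
      using that P[of i] by (simp add: P'_def fps_of_poly_mult fls_times_fps_to_fls mult.assoc)
  qed
  ultimately show ?case by blast
qed

section \<open>Uniqueness of the value at -1\<close>

text \<open>This is \<open>scale 0 u\<close> with the product by 0 already evaluated inside the
  mapped function.\<close>

lemma map_zero_poly_mapping: "Poly_Mapping.map (\<lambda>_. 0) u = 0"
  by (rule poly_mapping_eqI) (simp add: Poly_Mapping.map.rep_eq)

text \<open>The hypothesis says that a Laurent series with coefficients modulo \<open>R\<close>
  vanishes; hence so does its multiple by Q. In the induction Q = a + t Q', the factor t shifts the
  index to n - 1, and since all integers n are covered there is no boundary case.\<close>

lemma scale_sum_poly_mult:
  assumes R: "scale.subspace R"
    and F: "\<And>n. (\<Sum>i\<in>I. scale (fls_nth (F i) n) (u i)) \<in> R"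
  shows "(\<Sum>i\<in>I. scale (fls_nth (fps_to_fls (fps_of_poly Q) * F i) n) (u i)) \<in> R"
proof (induction Q arbitrary: n)
  case 0
  then show ?case by (simp add: map_zero_poly_mapping scale.subspace_0[OF R])
next
  case (pCons a Q)
  have "fls_nth (fps_to_fls (fps_of_poly (pCons a Q)) * F i) n =
      a * fls_nth (F i) n + fls_nth (fps_to_fls (fps_of_poly Q) * F i) (n - 1)" for i
    by (simp add: fps_of_poly_pCons fls_times_fps_to_fls ring_distribs mult.assoc
        fls_X_times_conv_shift fls_shifted_times_simps)
  then have "(\<Sum>i\<in>I. scale (fls_nth (fps_to_fls (fps_of_poly (pCons a Q)) * F i) n) (u i)) =
      scale a (\<Sum>i\<in>I. scale (fls_nth (F i) n) (u i)) +
      (\<Sum>i\<in>I. scale (fls_nth (fps_to_fls (fps_of_poly Q) * F i) (n - 1)) (u i))"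
    by (simp add: scale.scale_left_distrib scale.scale_sum_right sum.distrib)
  then show ?case
    using F pCons.IH by (simp add: scale.subspace_add[OF R] scale.subspace_scale[OF R])
qed

text \<open>Exchanging the two sums shows the value at a to be the combination of the coefficient
  sums with weights a^n, and \<open>R\<close> is closed under such combinations.\<close>

lemma scale_sum_poly_eval:
  assumes R: "scale.subspace R" and "finite I"
    and P: "\<And>n. (\<Sum>i\<in>I. scale (coeff (P i) n) (u i)) \<in> R"
  shows "(\<Sum>i\<in>I. scale (poly (P i) a) (u i)) \<in> R"
proof -
  \<comment> \<open>Inserting 0 keeps the maximum meaningful for empty \<open>I\<close>.\<close>
  define d where "d = Max (insert 0 ((degree \<circ> P) ` I))"
  have "poly (P i) a = (\<Sum>n\<le>d. coeff (P i) n * a ^ n)" if "i \<in> I" for i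
  proof -
    have "degree (P i) \<le> d" unfolding d_def using \<open>finite I\<close> that by (intro Max_ge) auto
    then show ?thesis
      by (auto simp: poly_altdef le_degree intro!: sum.mono_neutral_left)
  qed
  then have "(\<Sum>i\<in>I. scale (poly (P i) a) (u i)) =
      (\<Sum>i\<in>I. \<Sum>n\<le>d. scale (a ^ n) (scale (coeff (P i) n) (u i)))"
    by (simp add: scale.scale_sum_left mult.commute)
  also have "\<dots> = (\<Sum>n\<le>d. scale (a ^ n) (\<Sum>i\<in>I. scale (coeff (P i) n) (u i)))"
    by (subst sum.swap) (simp add: scale.scale_sum_right)
  also have "\<dots> \<in> R"
    by (intro scale.subspace_sum[OF R] scale.subspace_scale[OF R] P)
  finally show ?thesis .
qed

text \<open>A tensor whose expansion is zero modulo \<open>R\<close> has value zero modulo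
  \<open>R\<close>: multiply by the common denominator, evaluate the resulting polynomials, and
  divide by Q(-1).\<close>

lemma scale_sum_ratfun_eval:
  assumes R: "scale.subspace R" and "finite I"
    and r: "\<And>i. i \<in> I \<Longrightarrow> r i \<in> regular_at_minus_one"
    and 0: "\<And>n. (\<Sum>i\<in>I. scale (fls_nth (ratfun_laurent (r i)) n) (u i)) \<in> R"
  shows "(\<Sum>i\<in>I. scale (ratfun_eval (r i) (- 1)) (u i)) \<in> R"
proof -
  obtain Q P where Q: "poly Q (- 1) \<noteq> 0"
    and P: "\<And>i. i \<in> I \<Longrightarrow> fps_to_fls (fps_of_poly Q) * ratfun_laurent (r i) = fps_to_fls (fps_of_poly (P i))"
      "\<And>i. i \<in> I \<Longrightarrow> poly (P i) (- 1) = poly Q (- 1) * ratfun_eval (r i) (- 1)"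
    using common_denominator[of I r, OF \<open>finite I\<close> r] by blast
  have "(\<Sum>i\<in>I. scale (coeff (P i) n) (u i)) \<in> R" for n
    using scale_sum_poly_mult[OF R 0, of Q "int n"] P(1) by simp
  then have "(\<Sum>i\<in>I. scale (poly (P i) (- 1)) (u i)) \<in> R"
    by (rule scale_sum_poly_eval[OF R \<open>finite I\<close>])
  moreover have "scale (ratfun_eval (r i) (- 1)) (u i) =
      scale (inverse (poly Q (- 1))) (scale (poly (P i) (- 1)) (u i))" if "i \<in> I" for i
    using P(2)[OF that] Q by (simp add: mult.assoc[symmetric])
  then have "(\<Sum>i\<in>I. scale (ratfun_eval (r i) (- 1)) (u i)) =
      scale (inverse (poly Q (- 1))) (\<Sum>i\<in>I. scale (poly (P i) (- 1)) (u i))"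
    by (simp add: scale.scale_sum_right del: scale.scale_scale)
  ultimately show ?thesis by (simp add: scale.subspace_scale[OF R])
qed

lemma has_value_at_minus_one_iff:
  "has_value_at_minus_one G f v \<longleftrightarrow>
    (\<exists>(k::nat) u r.
      (\<forall>i<k. Poly_Mapping.keys (u i) \<subseteq> iso_classes G \<and> r i \<in> regular_at_minus_one) \<and>
      (\<forall>n. f n = quot_class G (\<Sum>i<k. scale (fls_nth (ratfun_laurent (r i)) n) (u i))) \<and>
      v = quot_class G (\<Sum>i<k. scale (ratfun_eval (r i) (- 1)) (u i)))"
  (is "_ \<longleftrightarrow> ?rhs")
proof
  assume "has_value_at_minus_one G f v"
  then obtain k :: nat and w r
    where w: "\<And>i. i < k \<Longrightarrow> w i \<in> carrier (burnside_ring G)"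
    and r: "\<And>i. i < k \<Longrightarrow> r i \<in> regular_at_minus_one"
    and f: "\<And>n. f n = (\<Oplus>\<^bsub>burnside_ring G\<^esub> i\<in>{..<k}.
                    fls_nth (ratfun_laurent (r i)) n \<odot>\<^bsub>burnside_ring G\<^esub> w i)"
    and v: "v = (\<Oplus>\<^bsub>burnside_ring G\<^esub> i\<in>{..<k}. ratfun_eval (r i) (- 1) \<odot>\<^bsub>burnside_ring G\<^esub> w i)"
    unfolding has_value_at_minus_one_def by blast
  have "\<exists>u. Poly_Mapping.keys u \<subseteq> iso_classes G \<and> w i = quot_class G u" if "i < k" for i
    using w[OF that] by (auto simp: carrier_burnside)
  then obtain u where u: "\<And>i. i < k \<Longrightarrow> Poly_Mapping.keys (u i) \<subseteq> iso_classes G \<and> w i = quot_class G (u i)"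
    by metis
  then have sum: "(\<Oplus>\<^bsub>burnside_ring G\<^esub> i\<in>{..<k}. c i \<odot>\<^bsub>burnside_ring G\<^esub> w i) =
      quot_class G (\<Sum>i<k. scale (c i) (u i))" for c
    by (intro finsum_smult_burnside) auto
  show ?rhs
    by (rule exI[of _ k], rule exI[of _ u], rule exI[of _ r]) (use u r f v sum in auto)
next
  assume ?rhs
  then obtain k :: nat and u r
    where u: "\<And>i. i < k \<Longrightarrow> Poly_Mapping.keys (u i) \<subseteq> iso_classes G"
    and r: "\<And>i. i < k \<Longrightarrow> r i \<in> regular_at_minus_one"
    and f: "\<And>n. f n = quot_class G (\<Sum>i<k. scale (fls_nth (ratfun_laurent (r i)) n) (u i))"
    and v: "v = quot_class G (\<Sum>i<k. scale (ratfun_eval (r i) (- 1)) (u i))"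
    by blast
  have sum: "(\<Oplus>\<^bsub>burnside_ring G\<^esub> i\<in>{..<k}. c i \<odot>\<^bsub>burnside_ring G\<^esub> quot_class G (u i)) =
      quot_class G (\<Sum>i<k. scale (c i) (u i))" for c
    using u by (intro finsum_smult_burnside) auto
  show "has_value_at_minus_one G f v"
    unfolding has_value_at_minus_one_def
    by (rule exI[of _ k], rule exI[of _ "\<lambda>i. quot_class G (u i)"], rule exI[of _ r])
      (use u r f v sum in \<open>auto simp: carrier_burnside\<close>)
qed

text \<open>This justifies the definite description in \<open>series_lefschetz\<close>.\<close>

lemma has_value_at_minus_one_unique:
  assumes "has_value_at_minus_one G f v" and "has_value_at_minus_one G f v'"
  shows "v = v'"
proof -
  note R = subspace_burnside_relations[of G]
  obtain k :: nat and u r where r: "\<And>i. i < k \<Longrightarrow> r i \<in> regular_at_minus_one"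
    and f: "\<And>n. f n = quot_class G (\<Sum>i<k. scale (fls_nth (ratfun_laurent (r i)) n) (u i))"
    and v: "v = quot_class G (\<Sum>i<k. scale (ratfun_eval (r i) (- 1)) (u i))"
    using assms(1) unfolding has_value_at_minus_one_iff by blast
  obtain k' :: nat and u' r' where r': "\<And>i. i < k' \<Longrightarrow> r' i \<in> regular_at_minus_one"
    and f': "\<And>n. f n = quot_class G (\<Sum>i<k'. scale (fls_nth (ratfun_laurent (r' i)) n) (u' i))"
    and v': "v' = quot_class G (\<Sum>i<k'. scale (ratfun_eval (r' i) (- 1)) (u' i))"
    using assms(2) unfolding has_value_at_minus_one_iff by blast
  \<comment> \<open>The difference of the two tensors, indexed by the disjoint sum of their index
    sets, is again a tensor, and its expansion is zero modulo the relations.\<close>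
  let ?r = "case_sum r r'" and ?u = "case_sum u (\<lambda>i. - u' i)"
  have split: "(\<Sum>i\<in>{..<k} <+> {..<k'}. scale (c (?r i)) (?u i)) =
      (\<Sum>i<k. scale (c (r i)) (u i)) - (\<Sum>i<k'. scale (c (r' i)) (u' i))"
    for c :: "rat poly fract \<Rightarrow> rat"
    by (simp add: sum.Plus sum_negf)
  have "(\<Sum>i\<in>{..<k} <+> {..<k'}. scale (ratfun_eval (?r i) (- 1)) (?u i)) \<in> burnside_relations G"
  proof (rule scale_sum_ratfun_eval[OF R])
    fix n
    show "(\<Sum>i\<in>{..<k} <+> {..<k'}. scale (fls_nth (ratfun_laurent (?r i)) n) (?u i)) \<in> burnside_relations G"
      unfolding split[of "\<lambda>r. fls_nth (ratfun_laurent r) n"]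
      using f[of n] f'[of n] by (simp only: quot_class_eq_iff[symmetric])
  qed (use r r' in auto)
  then show ?thesis
    unfolding split[of "\<lambda>r. ratfun_eval r (- 1)"] v v' quot_class_eq_iff .
qed

text \<open>\<open>F\<close> expands a rational function \<open>p/q\<close> that is regular at \<open>-1\<close> and has value \<open>a\<close> there.\<close>

definition series_value :: "rat fps \<Rightarrow> rat \<Rightarrow> bool"
  where "series_value F a \<longleftrightarrow> (\<exists>p q. poly q (- 1) \<noteq> 0 \<and>
    fps_of_poly q * F = fps_of_poly p \<and> poly p (- 1) = poly q (- 1) * a)"

lemma series_value_const: "series_value (fps_const c) c"
  unfolding series_value_def by (rule exI[of _ "[:c:]"], rule exI[of _ 1]) (simp add: fps_of_poly_const)

lemma series_value_add:
  assumes "series_value F a" and "series_value F' a'"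
  shows "series_value (F + F') (a + a')"
proof -
  obtain p q p' q' where *: "poly q (- 1) \<noteq> 0" "fps_of_poly q * F = fps_of_poly p"
      "poly p (- 1) = poly q (- 1) * a" "poly q' (- 1) \<noteq> 0" "fps_of_poly q' * F' = fps_of_poly p'"
      "poly p' (- 1) = poly q' (- 1) * a'"
    using assms unfolding series_value_def by blast
  have "fps_of_poly (q * q') * (F + F') =
      fps_of_poly q' * (fps_of_poly q * F) + fps_of_poly q * (fps_of_poly q' * F')"
    by (simp add: fps_of_poly_mult algebra_simps)
  also have "\<dots> = fps_of_poly (q' * p + q * p')"
    by (simp add: * fps_of_poly_mult fps_of_poly_add)
  finally show ?thesis
    unfolding series_value_def using *(1,3,4,6)
    by (intro exI[of _ "q' * p + q * p'"] exI[of _ "q * q'"]) (simp add: algebra_simps)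
qed

lemma series_value_mult:
  assumes "series_value F a" and "series_value F' a'"
  shows "series_value (F * F') (a * a')"
proof -
  obtain p q p' q' where *: "poly q (- 1) \<noteq> 0" "fps_of_poly q * F = fps_of_poly p"
      "poly p (- 1) = poly q (- 1) * a" "poly q' (- 1) \<noteq> 0" "fps_of_poly q' * F' = fps_of_poly p'"
      "poly p' (- 1) = poly q' (- 1) * a'"
    using assms unfolding series_value_def by blast
  have "fps_of_poly (q * q') * (F * F') = (fps_of_poly q * F) * (fps_of_poly q' * F')"
    by (simp add: fps_of_poly_mult algebra_simps)
  also have "\<dots> = fps_of_poly (p * p')"
    by (simp add: * fps_of_poly_mult)
  finally show ?thesis
    unfolding series_value_def using *(1,3,4,6)
    by (intro exI[of _ "p * p'"] exI[of _ "q * q'"]) (simp add: algebra_simps)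
qed

lemma series_value_sum:
  assumes "\<And>i. i \<in> I \<Longrightarrow> series_value (F i) (a i)"
  shows "series_value (\<Sum>i\<in>I. F i) (\<Sum>i\<in>I. a i)"
  using assms
  by (induction I rule: infinite_finite_induct)
    (use series_value_const[of 0] in \<open>auto intro!: series_value_add\<close>)

lemma series_value_X: "series_value fps_X (- 1)"
  unfolding series_value_def
  by (rule exI[of _ "[:0, 1:]"], rule exI[of _ 1]) (simp add: fps_of_poly_pCons)

text \<open>With D = p/q and D F = p'/q', the quotient F is (q p')/(q' p). Its denominator is
  nonzero at -1 because p(-1) = q(-1) d; this is where d must not vanish.\<close>

lemma series_value_cancel:
  assumes "series_value D d" "d \<noteq> 0" and "series_value (D * F) a"
  shows "series_value F (a / d)"
proof -
  obtain p q p' q' where *: "poly q (- 1) \<noteq> 0" "fps_of_poly q * D = fps_of_poly p"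
      "poly p (- 1) = poly q (- 1) * d" "poly q' (- 1) \<noteq> 0" "fps_of_poly q' * (D * F) = fps_of_poly p'"
      "poly p' (- 1) = poly q' (- 1) * a"
    using assms(1,3) unfolding series_value_def by blast
  have "fps_of_poly (q' * p) * F = fps_of_poly q' * (fps_of_poly q * D) * F"
    by (simp add: fps_of_poly_mult *)
  also have "\<dots> = fps_of_poly q * (fps_of_poly q' * (D * F))"
    by (simp add: algebra_simps)
  also have "\<dots> = fps_of_poly (q * p')"
    by (simp add: fps_of_poly_mult *)
  finally show ?thesis
    unfolding series_value_def using *(1,3,4,6) assms(2)
    by (intro exI[of _ "q * p'"] exI[of _ "q' * p"]) (simp add: algebra_simps)
qed

lemma series_value_ratfun:
  assumes "series_value F a"
  shows "\<exists>r \<in> regular_at_minus_one. ratfun_laurent r = fps_to_fls F \<and> ratfun_eval r (- 1) = a"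
proof -
  obtain p q where *: "poly q (- 1) \<noteq> 0" "fps_of_poly q * F = fps_of_poly p" "poly p (- 1) = poly q (- 1) * a"
    using assms unfolding series_value_def by blast
  then have "q \<noteq> 0" by auto
  have "fps_to_fls (fps_of_poly p) = fps_to_fls (fps_of_poly q) * fps_to_fls F"
    by (simp flip: * fls_times_fps_to_fls)
  then have "ratfun_laurent (Fract p q) = fps_to_fls F"
    using \<open>q \<noteq> 0\<close> by (simp add: ratfun_laurent_Fract)
  moreover have "ratfun_eval (Fract p q) (- 1) = a"
    using * by (simp add: ratfun_eval_Fract)
  moreover have "Fract p q \<in> regular_at_minus_one"
    using * by (auto simp: regular_at_minus_one_iff)
  ultimately show ?thesis by blast
qed


section \<open>Orbit decompositions in the Burnside ring\<close>

lemma gset_iso_sym: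
  assumes "group_action G (fst X) (snd X)" and "gset_iso G X Y"
  shows "gset_iso G Y X"
proof -
  obtain f where f: "bij_betw f (fst X) (fst Y)"
    and eq: "\<And>g x. g \<in> carrier G \<Longrightarrow> x \<in> fst X \<Longrightarrow> f (snd X g x) = snd Y g (f x)"
    using assms(2) by (auto simp: gset_iso_def)
  let ?f = "inv_into (fst X) f"
  have "?f (snd Y g y) = snd X g (?f y)" if g: "g \<in> carrier G" and y: "y \<in> fst Y" for g y
  proof -
    have x: "?f y \<in> fst X" using f y by (metis bij_betw_imp_surj_on inv_into_into)
    have "snd Y g y = f (snd X g (?f y))"
      using eq[OF g x] f y by (simp add: bij_betw_inv_into_right)
    moreover have "snd X g (?f y) \<in> fst X"
      using group_action.element_image[OF assms(1) g x] by blast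
    ultimately show ?thesis using f by (simp add: bij_betw_inv_into_left)
  qed
  then show ?thesis
    using bij_betw_inv_into[OF f] unfolding gset_iso_def by blast
qed

lemma gset_iso_trans:
  assumes "gset_iso G X Y" and "gset_iso G Y Z"
  shows "gset_iso G X Z"
proof -
  obtain f h where f: "bij_betw f (fst X) (fst Y)"
    and eqf: "\<And>g x. g \<in> carrier G \<Longrightarrow> x \<in> fst X \<Longrightarrow> f (snd X g x) = snd Y g (f x)"
    and h: "bij_betw h (fst Y) (fst Z)"
    and eqh: "\<And>g x. g \<in> carrier G \<Longrightarrow> x \<in> fst Y \<Longrightarrow> h (snd Y g x) = snd Z g (h x)"
    using assms by (auto simp: gset_iso_def)
  then have "\<forall>g\<in>carrier G. \<forall>x\<in>fst X. (h \<circ> f) (snd X g x) = snd Z g ((h \<circ> f) x)"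
    by (auto simp: bij_betw_apply)
  then show ?thesis
    using bij_betw_trans[OF f h] unfolding gset_iso_def by blast
qed

lemma iso_class_cong:
  assumes "group_action G (fst X) (snd X)" and "gset_iso G X Y"
  shows "iso_class G X = iso_class G Y"
  unfolding iso_class_def
  using gset_iso_trans[OF assms(2)] gset_iso_trans[OF gset_iso_sym[OF assms]] by blast

lemma group_action_memI:
  assumes "group_action G E \<phi>" "g \<in> carrier G" "x \<in> E"
  shows "\<phi> g x \<in> E"
  using group_action.element_image[OF assms] by simp

lemma group_action_one:
  assumes "group_action G E \<phi>" "x \<in> E"
  shows "\<phi> \<one>\<^bsub>G\<^esub> x = x"
  using group_action.id_eq_one[OF assms(1)] assms(2) by (metis restrict_apply')

lemma group_action_group: "group_action G E \<phi> \<Longrightarrow> group G"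
  by (simp add: group_action_def group_hom_def)

lemma group_action_transport:
  assumes act: "group_action G E \<phi>" and f: "bij_betw f E F"
  shows "group_action G F (\<lambda>g. restrict (\<lambda>y. f (\<phi> g (inv_into E f y))) F)"
proof (rule group_action_restrictI)
  have inv: "inv_into E f y \<in> E" if "y \<in> F" for y
    using f that by (metis bij_betw_imp_surj_on inv_into_into)
  show "group G" by (rule group_action_group[OF act])
  show "f (\<phi> g (inv_into E f y)) \<in> F" if "g \<in> carrier G" "y \<in> F" for g y
    using f group_action_memI[OF act that(1) inv[OF that(2)]] by (rule bij_betw_apply)
  show "f (\<phi> \<one>\<^bsub>G\<^esub> (inv_into E f y)) = y" if "y \<in> F" for y
    using that f by (simp add: group_action_one[OF act inv] bij_betw_inv_into_right)
  show "f (\<phi> (g \<otimes>\<^bsub>G\<^esub> h) (inv_into E f y)) =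
      f (\<phi> g (inv_into E f (f (\<phi> h (inv_into E f y)))))"
    if "g \<in> carrier G" "h \<in> carrier G" "y \<in> F" for g h y
    using that f inv[OF that(3)]
    by (simp add: group_action.composition_rule[OF act] bij_betw_inv_into_left group_action_memI[OF act])
qed

text \<open>\<open>iso_classes\<close> and \<open>burnside_relations\<close> speak only of G-sets on
  natural numbers, while simplices and cosets live on other types; this lemma passes between
  them.\<close>

lemma finite_gset_nat_copy:
  assumes "finite_gset G X"
  obtains Y :: "('g, nat) gset" where "finite_gset G Y" "gset_iso G X Y"
proof -
  have fin: "finite (fst X)" and act: "group_action G (fst X) (snd X)"
    using assms by (auto simp: finite_gset_def)
  obtain f and n :: nat where f: "bij_betw f (fst X) {0..<n}"
    using ex_bij_betw_finite_nat[OF fin] by blast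
  let ?Y = "({0..<n}, \<lambda>g. restrict (\<lambda>y. f (snd X g (inv_into (fst X) f y))) {0..<n})"
  have "finite_gset G ?Y"
    using group_action_transport[OF act f] by (simp add: finite_gset_def)
  moreover have "gset_iso G X ?Y"
    unfolding gset_iso_def using f
    by (intro exI[of _ f]) (auto simp: bij_betw_inv_into_left dest: bij_betw_apply)
  ultimately show thesis by (rule that)
qed

lemma iso_class_in_iso_classes:
  assumes "finite_gset G X"
  shows "iso_class G X \<in> iso_classes G"
proof -
  obtain Y :: "('a, nat) gset" where "finite_gset G Y" "gset_iso G X Y"
    using assms by (rule finite_gset_nat_copy)
  then show ?thesis
    using iso_class_cong[of G X Y] assms unfolding iso_classes_def finite_gset_def by blast
qed

abbreviation free_class :: "('g, 'k) monoid_scheme \<Rightarrow> ('g, 'x) gset \<Rightarrow> ('g gset_class \<Rightarrow>\<^sub>0 rat)"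
  where "free_class G X \<equiv> Poly_Mapping.single (iso_class G X) 1"

lemma burnside_class_eq: "burnside_class G X = quot_class G (free_class G X)"
  by (simp add: burnside_class_def quot_class_def)

lemma finite_gset_sum:
  assumes "finite_gset G X" "finite_gset G Y"
  shows "finite_gset G (gset_sum X Y)"
proof -
  have X: "group_action G (fst X) (snd X)" and Y: "group_action G (fst Y) (snd Y)"
    using assms by (auto simp: finite_gset_def)
  have "group_action G (Inl ` fst X \<union> Inr ` fst Y)
      (\<lambda>g. restrict (map_sum (snd X g) (snd Y g)) (Inl ` fst X \<union> Inr ` fst Y))"
    by (rule group_action_restrictI[OF group_action_group[OF X]])
      (auto simp: group_action_memI[OF X] group_action_memI[OF Y] group_action_one[OF X]
        group_action_one[OF Y] group_action.composition_rule[OF X] group_action.composition_rule[OF Y])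
  then show ?thesis using assms by (simp add: finite_gset_def gset_sum_def)
qed

lemma gset_iso_sum:
  assumes "group_action G (fst X) (snd X)" "group_action G (fst Y) (snd Y)"
    and "gset_iso G X X'" "gset_iso G Y Y'"
  shows "gset_iso G (gset_sum X Y) (gset_sum X' Y')"
proof -
  obtain f h where f: "bij_betw f (fst X) (fst X')"
    and eqf: "\<And>g x. g \<in> carrier G \<Longrightarrow> x \<in> fst X \<Longrightarrow> f (snd X g x) = snd X' g (f x)"
    and h: "bij_betw h (fst Y) (fst Y')"
    and eqh: "\<And>g x. g \<in> carrier G \<Longrightarrow> x \<in> fst Y \<Longrightarrow> h (snd Y g x) = snd Y' g (h x)"
    using assms(3,4) by (auto simp: gset_iso_def)
  have "inj_on (map_sum f h) (fst (gset_sum X Y))"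
    using inj_onD[OF bij_betw_imp_inj_on[OF f]] inj_onD[OF bij_betw_imp_inj_on[OF h]]
    by (auto simp: gset_sum_def intro!: inj_onI)
  moreover have "map_sum f h ` fst (gset_sum X Y) = fst (gset_sum X' Y')"
    using bij_betw_imp_surj_on[OF f] bij_betw_imp_surj_on[OF h]
    by (simp add: gset_sum_def image_Un image_image flip: image_image[of Inl f] image_image[of Inr h])
  ultimately have "bij_betw (map_sum f h) (fst (gset_sum X Y)) (fst (gset_sum X' Y'))"
    by (simp add: bij_betw_def)
  moreover have "map_sum f h (snd (gset_sum X Y) g z) = snd (gset_sum X' Y') g (map_sum f h z)"
    if "g \<in> carrier G" "z \<in> fst (gset_sum X Y)" for g z
    using that bij_betw_apply[OF f] bij_betw_apply[OF h] by (auto simp: gset_sum_def eqf eqh)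
  ultimately show ?thesis unfolding gset_iso_def by blast
qed

text \<open>The generating relations, extended to arbitrary types by replacing both summands with
  copies on natural numbers.\<close>

lemma free_class_sum:
  assumes "finite_gset G X" "finite_gset G Y"
  shows "free_class G (gset_sum X Y) - free_class G X - free_class G Y \<in> burnside_relations G"
proof -
  obtain X' :: "('a, nat) gset" where X': "finite_gset G X'" "gset_iso G X X'"
    using assms(1) by (rule finite_gset_nat_copy)
  obtain Y' :: "('a, nat) gset" where Y': "finite_gset G Y'" "gset_iso G Y Y'"
    using assms(2) by (rule finite_gset_nat_copy)
  have "iso_class G X = iso_class G X'" "iso_class G Y = iso_class G Y'"
    using assms X' Y' by (auto intro!: iso_class_cong simp: finite_gset_def)
  moreover have "iso_class G (gset_sum X Y) = iso_class G (gset_sum X' Y')"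
    using assms X' Y' finite_gset_sum[OF assms]
    by (intro iso_class_cong gset_iso_sum) (auto simp: finite_gset_def)
  moreover have "free_class G (gset_sum X' Y') - free_class G X' - free_class G Y' \<in> burnside_relations G"
    unfolding burnside_relations_def using X'(1) Y'(1) by (intro scale.span_base) blast
  ultimately show ?thesis by simp
qed

section \<open>Splitting a G-set into orbits\<close>

definition restrict_gset :: "('g, 'x) gset \<Rightarrow> 'x set \<Rightarrow> ('g, 'x) gset"
  where "restrict_gset X A = (A, \<lambda>g. restrict (snd X g) A)"

lemma finite_gset_restrict:
  assumes "finite_gset G X" and "A \<subseteq> fst X"
    and "\<And>g x. \<lbrakk>g \<in> carrier G; x \<in> A\<rbrakk> \<Longrightarrow> snd X g x \<in> A"
  shows "finite_gset G (restrict_gset X A)"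
proof -
  have X: "group_action G (fst X) (snd X)" using assms(1) by (simp add: finite_gset_def)
  have "group_action G A (\<lambda>g. restrict (snd X g) A)"
    by (rule group_action_restrictI[OF group_action_group[OF X]])
      (use assms(2,3) in \<open>auto simp: group_action_one[OF X] group_action.composition_rule[OF X] subsetD\<close>)
  moreover have "finite A" using assms(1,2) finite_subset by (auto simp: finite_gset_def)
  ultimately show ?thesis by (simp add: finite_gset_def restrict_gset_def)
qed

text \<open>The two inclusions together identify the disjoint sum of an invariant subset and its
  complement with \<open>X\<close>.\<close>

lemma free_class_split:
  assumes X: "finite_gset G X" and A: "A \<subseteq> fst X"
    and closed: "\<And>g x. \<lbrakk>g \<in> carrier G; x \<in> A\<rbrakk> \<Longrightarrow> snd X g x \<in> A"
    and closed': "\<And>g x. \<lbrakk>g \<in> carrier G; x \<in> fst X - A\<rbrakk> \<Longrightarrow> snd X g x \<in> fst X - A"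
  shows "free_class G X - free_class G (restrict_gset X A) - free_class G (restrict_gset X (fst X - A))
    \<in> burnside_relations G"
proof -
  let ?S = "gset_sum (restrict_gset X A) (restrict_gset X (fst X - A))"
  have fin: "finite_gset G (restrict_gset X A)" "finite_gset G (restrict_gset X (fst X - A))"
    using assms by (auto intro!: finite_gset_restrict)
  have "bij_betw (case_sum id id) (fst ?S) (fst X)"
    using A by (auto simp: bij_betw_def inj_on_def gset_sum_def restrict_gset_def image_Un image_image)
  moreover have "case_sum id id (snd ?S g z) = snd X g (case_sum id id z)"
    if "g \<in> carrier G" "z \<in> fst ?S" for g z
    using that by (auto simp: gset_sum_def restrict_gset_def)
  ultimately have "gset_iso G ?S X" unfolding gset_iso_def by blast
  then have "iso_class G ?S = iso_class G X"
    using finite_gset_sum[OF fin] by (intro iso_class_cong) (auto simp: finite_gset_def)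
  then show ?thesis using free_class_sum[OF fin] by simp
qed

lemma orbit_eq_image: "orbit G \<phi> x = (\<lambda>g. \<phi> g x) ` carrier G"
  by (auto simp: orbit_def)

lemma orbit_closed:
  assumes act: "group_action G E \<phi>" and "x \<in> E" "y \<in> orbit G \<phi> x" "g \<in> carrier G"
  shows "\<phi> g y \<in> orbit G \<phi> x"
proof -
  interpret group G by (rule group_action_group[OF act])
  obtain h where h: "h \<in> carrier G" "y = \<phi> h x" using assms(3) by (auto simp: orbit_eq_image)
  then have "\<phi> g y = \<phi> (g \<otimes>\<^bsub>G\<^esub> h) x"
    using assms by (simp add: group_action.composition_rule[OF act])
  then show ?thesis using assms(4) h(1) by (auto simp: orbit_eq_image)
qed

lemma orbit_eq:
  assumes act: "group_action G E \<phi>" and x: "x \<in> E" and y: "y \<in> orbit G \<phi> x"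
  shows "orbit G \<phi> y = orbit G \<phi> x"
proof -
  have sub: "orbit G \<phi> b \<subseteq> orbit G \<phi> a" if "a \<in> E" "b \<in> orbit G \<phi> a" for a b
    using orbit_closed[OF act that] by (auto simp: orbit_eq_image)
  have yE: "y \<in> E" using y x group_action_memI[OF act] by (auto simp: orbit_eq_image)
  have "x \<in> orbit G \<phi> y" by (rule group_action.orbit_sym[OF act x yE y])
  then show ?thesis using sub[OF x y] sub[OF yE] by blast
qed

text \<open>Orbit and stabilizer without chosen representatives: a point corresponds to the set of
  all group elements that carry x to it, and this set is a left coset of the stabilizer.\<close>

lemma orbit_coset_bij:
  assumes act: "group_action G E \<phi>" and x: "x \<in> E"
  shows "bij_betw (\<lambda>y. {g \<in> carrier G. \<phi> g x = y}) (orbit G \<phi> x) (lcosets\<^bsub>G\<^esub> (stabilizer G \<phi> x))"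
    and "h \<in> carrier G \<Longrightarrow> {g \<in> carrier G. \<phi> g x = \<phi> h x} = h <#\<^bsub>G\<^esub> stabilizer G \<phi> x"
proof -
  interpret group G by (rule group_action_group[OF act])
  have coset: "{g \<in> carrier G. \<phi> g x = \<phi> h x} = h <#\<^bsub>G\<^esub> stabilizer G \<phi> x" if h: "h \<in> carrier G" for h
  proof (intro Set.set_eqI iffI)
    fix g assume "g \<in> {g \<in> carrier G. \<phi> g x = \<phi> h x}"
    then have g: "g \<in> carrier G" and eq: "\<phi> g x = \<phi> h x" by auto
    have "\<phi> (inv\<^bsub>G\<^esub> h \<otimes>\<^bsub>G\<^esub> g) x = \<phi> (inv\<^bsub>G\<^esub> h \<otimes>\<^bsub>G\<^esub> h) x"
      using g h x eq by (simp only: group_action.composition_rule[OF act] inv_closed)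
    then have "inv\<^bsub>G\<^esub> h \<otimes>\<^bsub>G\<^esub> g \<in> stabilizer G \<phi> x"
      using g h x by (simp add: stabilizer_def group_action_one[OF act])
    moreover have "g = h \<otimes>\<^bsub>G\<^esub> (inv\<^bsub>G\<^esub> h \<otimes>\<^bsub>G\<^esub> g)" using g h by (simp add: m_assoc[symmetric])
    ultimately show "g \<in> h <#\<^bsub>G\<^esub> stabilizer G \<phi> x" unfolding l_coset_def by blast
  next
    fix g assume "g \<in> h <#\<^bsub>G\<^esub> stabilizer G \<phi> x"
    then show "g \<in> {g \<in> carrier G. \<phi> g x = \<phi> h x}"
      using h x by (auto simp: l_coset_def stabilizer_def group_action.composition_rule[OF act])
  qed
  then show "h \<in> carrier G \<Longrightarrow> {g \<in> carrier G. \<phi> g x = \<phi> h x} = h <#\<^bsub>G\<^esub> stabilizer G \<phi> x" .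
  have "inj_on (\<lambda>y. {g \<in> carrier G. \<phi> g x = y}) (orbit G \<phi> x)"
  proof (rule inj_onI)
    fix y z assume "y \<in> orbit G \<phi> x" and eq: "{g \<in> carrier G. \<phi> g x = y} = {g \<in> carrier G. \<phi> g x = z}"
    then obtain h where "h \<in> {g \<in> carrier G. \<phi> g x = y}" by (auto simp: orbit_eq_image)
    then show "y = z" using eq by auto
  qed
  then show "bij_betw (\<lambda>y. {g \<in> carrier G. \<phi> g x = y}) (orbit G \<phi> x) (lcosets\<^bsub>G\<^esub> (stabilizer G \<phi> x))"
    by (auto simp: bij_betw_def orbit_eq_image image_image coset LCOSETS_def)
qed

lemma gset_iso_orbit:
  assumes act: "group_action G (fst X) (snd X)" and x: "x \<in> fst X"
  shows "gset_iso G (restrict_gset X (orbit G (snd X) x)) (coset_gset G (stabilizer G (snd X) x))"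
proof -
  interpret group G by (rule group_action_group[OF act])
  let ?S = "stabilizer G (snd X) x" and ?f = "\<lambda>y. {g \<in> carrier G. snd X g x = y}"
  have S: "?S \<subseteq> carrier G" by (auto simp: stabilizer_def)
  have "?f (snd X g y) = g <#\<^bsub>G\<^esub> ?f y" if g: "g \<in> carrier G" and y: "y \<in> orbit G (snd X) x" for g y
  proof -
    obtain h where h: "h \<in> carrier G" "y = snd X h x" using y by (auto simp: orbit_eq_image)
    then have "?f (snd X g y) = ?f (snd X (g \<otimes>\<^bsub>G\<^esub> h) x)"
      using g x by (simp add: group_action.composition_rule[OF act])
    also have "\<dots> = g <#\<^bsub>G\<^esub> (h <#\<^bsub>G\<^esub> ?S)"
      using g h S by (simp add: orbit_coset_bij(2)[OF act x] lcos_m_assoc)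
    finally show ?thesis using h by (simp add: orbit_coset_bij(2)[OF act x])
  qed
  moreover have "?f y \<in> lcosets\<^bsub>G\<^esub> ?S" if "y \<in> orbit G (snd X) x" for y
    using orbit_coset_bij(1)[OF act x] that by (rule bij_betw_apply)
  ultimately show ?thesis
    using orbit_coset_bij(1)[OF act x]
    by (auto simp: gset_iso_def restrict_gset_def coset_gset_def intro!: exI[of _ ?f])
qed

text \<open>The induction removes one orbit at a time. The points of an orbit have equal terms with
  weights adding up to 1, so together they contribute the class of the orbit once.\<close>

lemma free_class_orbits:
  assumes "finite_gset G X"
  shows "free_class G X -
      (\<Sum>x\<in>fst X. scale (1 / of_nat (card (orbit G (snd X) x))) (free_class G (restrict_gset X (orbit G (snd X) x))))
    \<in> burnside_relations G"
  using assms
proof (induction "card (fst X)" arbitrary: X rule: less_induct)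
  case (less X)
  note R = subspace_burnside_relations[of G]
  have fin: "finite (fst X)" and act: "group_action G (fst X) (snd X)"
    using less.prems by (auto simp: finite_gset_def)
  interpret group G by (rule group_action_group[OF act])
  show ?case
  proof (cases "fst X = {}")
    case True
    \<comment> \<open>The empty G-set is its own disjoint double, so the relation [X] - [X] - [X]
      shows that its class is zero.\<close>
    have "free_class G X - free_class G (restrict_gset X {}) - free_class G (restrict_gset X (fst X - {})) \<in> burnside_relations G"
      by (rule free_class_split[OF less.prems]) (use True in auto)
    moreover have "gset_iso G X (restrict_gset X {})"
      using True by (simp add: gset_iso_def restrict_gset_def bij_betw_def)
    then have "iso_class G X = iso_class G (restrict_gset X {})"
      by (rule iso_class_cong[OF act])
    ultimately have "- free_class G X \<in> burnside_relations G" using True by simp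
    from scale.subspace_neg[OF R this] show ?thesis using True by simp
  next
    case False
    then obtain x where x: "x \<in> fst X" by blast
    let ?O = "orbit G (snd X)"
    define Y where "Y = restrict_gset X (fst X - ?O x)"
    have sub: "?O y \<subseteq> fst X" if "y \<in> fst X" for y
      using group_action_memI[OF act _ that] by (auto simp: orbit_eq_image)
    have orb_refl: "y \<in> ?O y" if "y \<in> fst X" for y
      by (rule group_action.orbit_refl[OF act that])
    have closed': "snd X g y \<in> fst X - ?O x" if g: "g \<in> carrier G" and y: "y \<in> fst X - ?O x" for g y
    proof -
      have "snd X g y \<in> ?O y" using g by (auto simp: orbit_eq_image)
      then have "?O (snd X g y) = ?O y" using orbit_eq[OF act] y by auto
      moreover have "?O (snd X g y) = ?O x" if "snd X g y \<in> ?O x"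
        using orbit_eq[OF act x that] .
      ultimately show ?thesis
        using y orb_refl[of y] group_action_memI[OF act g] by auto
    qed
    have finY: "finite_gset G Y"
      unfolding Y_def by (rule finite_gset_restrict[OF less.prems _ closed']) auto
    have fstY: "fst Y = fst X - ?O x" by (simp add: Y_def restrict_gset_def)
    have "card (fst Y) < card (fst X)"
      unfolding fstY using fin x orb_refl[OF x] by (intro psubset_card_mono) auto
    note IH = less.hyps[OF this finY]
    \<comment> \<open>Orbits of points outside the removed one are the same G-sets in
      \<open>Y\<close> as in \<open>X\<close>, so the induction hypothesis sums the very terms
      needed.\<close>
    have orbY: "orbit G (snd Y) y = ?O y" if "y \<in> fst Y" for y
      using that by (simp add: orbit_eq_image Y_def restrict_gset_def)
    have resY: "restrict_gset Y (?O y) = restrict_gset X (?O y)" if "y \<in> fst Y" for y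
    proof -
      have "?O y \<subseteq> fst Y" using closed' that by (auto simp: orbit_eq_image fstY)
      then show ?thesis
        by (auto simp: restrict_gset_def Y_def fun_eq_iff restrict_def)
    qed
    let ?t = "\<lambda>y. scale (1 / of_nat (card (?O y))) (free_class G (restrict_gset X (?O y)))"
    have IH': "free_class G Y - (\<Sum>y\<in>fst Y. ?t y) \<in> burnside_relations G"
      using IH by (simp add: orbY resY)
    have finO: "finite (?O x)" using finite_subset[OF sub[OF x] fin] .
    have "(\<Sum>y\<in>?O x. ?t y) = (\<Sum>y\<in>?O x. ?t x)"
    proof (rule sum.cong[OF refl])
      fix y assume "y \<in> ?O x"
      from orbit_eq[OF act x this] show "?t y = ?t x" by (rule arg_cong)
    qed
    also have "\<dots> = scale (\<Sum>y\<in>?O x. 1 / of_nat (card (?O x))) (free_class G (restrict_gset X (?O x)))"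
      by (simp only: scale.scale_sum_left)
    also have "(\<Sum>y\<in>?O x. 1 / of_nat (card (?O x))) = (1::rat)"
      using finO orb_refl[OF x] by auto
    finally have orb: "(\<Sum>y\<in>?O x. ?t y) = free_class G (restrict_gset X (?O x))"
      by (simp only: scale.scale_one)
    have split: "(\<Sum>y\<in>fst X. ?t y) = (\<Sum>y\<in>fst Y. ?t y) + (\<Sum>y\<in>?O x. ?t y)"
      unfolding fstY by (rule sum.subset_diff[OF sub[OF x] fin])
    have "free_class G X - free_class G (restrict_gset X (?O x)) - free_class G Y \<in> burnside_relations G"
      unfolding Y_def by (rule free_class_split[OF less.prems sub[OF x] _ closed'])
        (auto intro: orbit_closed[OF act x])
    from scale.subspace_add[OF R this IH'] show ?thesis
      unfolding split orb by (simp add: algebra_simps)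
  qed
qed

lemma free_class_stabilizers:
  assumes "finite_gset G X" and stab: "\<And>x. x \<in> fst X \<Longrightarrow> stabilizer G (snd X) x = S x"
  shows "free_class G X -
      (\<Sum>x\<in>fst X. scale (1 / of_nat (card (lcosets\<^bsub>G\<^esub> (S x)))) (free_class G (coset_gset G (S x))))
    \<in> burnside_relations G"
proof -
  have act: "group_action G (fst X) (snd X)" using assms(1) by (simp add: finite_gset_def)
  have "card (orbit G (snd X) x) = card (lcosets\<^bsub>G\<^esub> (S x))"
    "iso_class G (restrict_gset X (orbit G (snd X) x)) = iso_class G (coset_gset G (S x))"
    if x: "x \<in> fst X" for x
  proof -
    show "card (orbit G (snd X) x) = card (lcosets\<^bsub>G\<^esub> (S x))"
      using bij_betw_same_card[OF orbit_coset_bij(1)[OF act x]] stab[OF x] by simp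
    have "finite_gset G (restrict_gset X (orbit G (snd X) x))"
    proof (rule finite_gset_restrict[OF assms(1)])
      show "orbit G (snd X) x \<subseteq> fst X"
        using group_action_memI[OF act _ x] by (auto simp: orbit_eq_image)
    qed (rule orbit_closed[OF act x])
    then show "iso_class G (restrict_gset X (orbit G (snd X) x)) = iso_class G (coset_gset G (S x))"
      using iso_class_cong[OF _ gset_iso_orbit[OF act x]] stab[OF x] by (simp add: finite_gset_def)
  qed
  then show ?thesis using free_class_orbits[OF assms(1)] by simp
qed


section \<open>Weighted chains in a finite poset\<close>

text \<open>For natural weights, this counts the non-degenerate n-chains from a fixed object over y
  in the preorder where each x is replaced by w x mutually isomorphic objects. The
  \<open>of_bool\<close> term excludes the object itself, whose only arrow to itself is the
  identity.\<close>

primrec chain_weight :: "'a::order set \<Rightarrow> ('a \<Rightarrow> rat) \<Rightarrow> nat \<Rightarrow> 'a \<Rightarrow> rat"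
  where
    "chain_weight P w 0 y = 1"
  | "chain_weight P w (Suc n) y =
      (\<Sum>x\<in>{x \<in> P. x \<le> y}. (w x - of_bool (x = y)) * chain_weight P w n x)"

text \<open>The defining recursion with the term 1 at \<open>None\<close> split off, which leaves a
  sum over \<open>P\<close> alone.\<close>

lemma mobius_add_minimum:
  fixes P :: "'a::order set"
  assumes "finite P" "y \<in> P"
  shows "mobius (add_minimum P) None (Some y) =
    - 1 - (\<Sum>x\<in>{x \<in> P. x < y}. mobius (add_minimum P) None (Some x))"
proof -
  have "finite (add_minimum P)" using assms by (simp add: add_minimum_def)
  moreover have "mobius (add_minimum P) None None = 1"
    by (subst mobius.simps) (use assms in \<open>simp add: add_minimum_def\<close>)
  moreover have "{z \<in> add_minimum P. None \<le> z \<and> z < Some y} = insert None (Some ` {x \<in> P. x < y})"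
    by (auto simp: add_minimum_def)
  moreover have "None \<notin> Some ` {x \<in> P. x < y}" by blast
  ultimately show ?thesis
    using assms by (subst mobius.simps) (simp add: add_minimum_def sum.reindex)
qed

text \<open>The functional equation expresses the series at y through those at x < y, so induction
  on the number of elements below y applies. At -1 each product w x (- m x / w x) collapses to - m
  x, and the right-hand side becomes the Moebius recursion.\<close>

lemma series_value_chain_weight:
  fixes P :: "'a::order set"
  assumes P: "finite P" and w: "\<And>x. x \<in> P \<Longrightarrow> w x \<noteq> 0" and "y \<in> P"
  shows "series_value (Abs_fps (\<lambda>n. chain_weight P w n y))
    (- of_int (mobius (add_minimum P) None (Some y)) / w y)"
  using \<open>y \<in> P\<close>
proof (induction "card {x \<in> P. x < y}" arbitrary: y rule: less_induct)
  case (less y)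
  define F where "F = (\<lambda>x. Abs_fps (\<lambda>n. chain_weight P w n x))"
  define m :: "'a \<Rightarrow> rat" where "m = (\<lambda>x. of_int (mobius (add_minimum P) None (Some x)))"
  have IH: "series_value (F x) (- m x / w x)" if "x \<in> P" "x < y" for x
  proof -
    have "{z \<in> P. z < x} \<subset> {z \<in> P. z < y}" using that by auto
    then have "card {z \<in> P. z < x} < card {z \<in> P. z < y}"
      using P by (intro psubset_card_mono) auto
    from less.hyps[OF this that(1)] show ?thesis by (simp add: F_def m_def)
  qed
  have eq: "{x \<in> P. x \<le> y} = insert y {x \<in> P. x < y}" using less.prems by auto
  \<comment> \<open>The recursion of \<open>chain_weight\<close> as a generating function, with the
    summand x = y, of weight w y - 1, set apart.\<close>
  have "F y = 1 + fps_X * (fps_const (w y - 1) * F y + (\<Sum>x\<in>{x \<in> P. x < y}. fps_const (w x) * F x))"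
  proof (rule fps_ext)
    fix n
    show "fps_nth (F y) n =
      fps_nth (1 + fps_X * (fps_const (w y - 1) * F y + (\<Sum>x\<in>{x \<in> P. x < y}. fps_const (w x) * F x))) n"
    proof (cases n)
      case (Suc k)
      have "(\<Sum>x\<in>{x \<in> P. x < y}. (w x - of_bool (x = y)) * chain_weight P w k x) =
          (\<Sum>x\<in>{x \<in> P. x < y}. w x * chain_weight P w k x)"
        by (intro sum.cong) auto
      then show ?thesis using P by (simp add: F_def Suc eq fps_sum_nth)
    qed (simp add: F_def)
  qed
  then have "(1 + fps_const (1 - w y) * fps_X) * F y =
      1 + fps_X * (\<Sum>x\<in>{x \<in> P. x < y}. fps_const (w x) * F x)"
    by (simp add: algebra_simps flip: fps_const_sub)
  moreover have "series_value (1 + fps_X * (\<Sum>x\<in>{x \<in> P. x < y}. fps_const (w x) * F x))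
      (1 + (- 1) * (\<Sum>x\<in>{x \<in> P. x < y}. w x * (- m x / w x)))"
    using IH series_value_const[of 1]
    by (intro series_value_add series_value_mult series_value_X series_value_sum series_value_const) auto
  moreover have "1 + (- 1) * (\<Sum>x\<in>{x \<in> P. x < y}. w x * (- m x / w x)) = - m y"
  proof -
    have "(\<Sum>x\<in>{x \<in> P. x < y}. w x * (- m x / w x)) = (\<Sum>x\<in>{x \<in> P. x < y}. - m x)"
      by (intro sum.cong refl) (use w in auto)
    then show ?thesis
      using mobius_add_minimum[OF P less.prems] by (simp add: m_def sum_negf)
  qed
  ultimately have "series_value ((1 + fps_const (1 - w y) * fps_X) * F y) (- m y)" by simp
  \<comment> \<open>The value is 1 - (1 - w y) = w y, the divisor in the claim.\<close>
  moreover have "series_value (1 + fps_const (1 - w y) * fps_X) (1 + (1 - w y) * (- 1))"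
    using series_value_const[of 1]
    by (intro series_value_add series_value_mult series_value_X series_value_const) auto
  ultimately have "series_value (F y) (- m y / w y)"
    using series_value_cancel[of "1 + fps_const (1 - w y) * fps_X" "w y" "F y" "- m y"] w[OF less.prems]
    by simp
  then show ?case by (simp add: F_def m_def)
qed


section \<open>The simplices of a finite category with a group action\<close>

lemma (in finite_category) finite_simplices: "finite (simplices D n)"
proof -
  have "set ms \<subseteq> arr D \<and> x \<in> obj D" if "nondeg_chain D x ms" for x ms
    using that by (induction ms arbitrary: x) (auto dest: src_closed)
  then have "simplices D n \<subseteq> obj D \<times> {ms. set ms \<subseteq> arr D \<and> length ms = n}"
    by (auto simp: simplices_def)
  then show ?thesis
    by (rule finite_subset) (simp add: finite_obj finite_arr finite_lists_length_eq)
qed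

text \<open>A group element acts injectively on arrows and maps identities to identities, so it
  cannot make an arrow degenerate.\<close>

lemma (in finite_gcategory) nondeg_chain_act:
  assumes "g \<in> carrier G" "nondeg_chain D x ms"
  shows "nondeg_chain D (obj_act D g x) (map (arr_act D g) ms)"
  using assms(2)
proof (induction ms arbitrary: x)
  case Nil
  then show ?case using assms(1) group_action_memI[OF obj_action] by simp
next
  case (Cons m ms)
  then have m: "m \<in> arr D" "src D m = x" "m \<noteq> idn D x" "nondeg_chain D (tgt D m) ms" by auto
  then have x: "x \<in> obj D" using src_closed by blast
  have "arr_act D g m \<noteq> arr_act D g (idn D x)"
    using group_action.inj_prop[OF arr_action assms(1)] m(1,3) idn_closed[OF x] by (auto dest: inj_onD)
  then show ?case
    using Cons.IH[OF m(4)] m assms(1) x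
    by (simp add: group_action_memI[OF arr_action] src_act tgt_act idn_act)
qed

lemma (in finite_gcategory) finite_gset_simplex: "finite_gset G (simplex_gset D n)"
proof -
  have chainD: "set ms \<subseteq> arr D" "x \<in> obj D" if "nondeg_chain D x ms" for x ms
    using that by (induction ms arbitrary: x) (auto dest: src_closed)
  have "group_action G (simplices D n)
      (\<lambda>g. restrict (map_prod (obj_act D g) (map (arr_act D g))) (simplices D n))"
  proof (rule group_action_restrictI[OF group_action_group[OF obj_action]])
    fix g s assume "g \<in> carrier G" "s \<in> simplices D n"
    then show "map_prod (obj_act D g) (map (arr_act D g)) s \<in> simplices D n"
      by (auto simp: simplices_def nondeg_chain_act)
  next
    fix s assume "s \<in> simplices D n"
    then obtain x ms where s: "s = (x, ms)" "nondeg_chain D x ms" by (auto simp: simplices_def)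
    show "map_prod (obj_act D \<one>\<^bsub>G\<^esub>) (map (arr_act D \<one>\<^bsub>G\<^esub>)) s = s"
      using chainD[OF s(2)]
      by (auto simp: s(1) group_action_one[OF obj_action] group_action_one[OF arr_action]
          intro!: map_idI)
  next
    fix g h s assume gh: "g \<in> carrier G" "h \<in> carrier G" and "s \<in> simplices D n"
    then obtain x ms where s: "s = (x, ms)" "nondeg_chain D x ms" by (auto simp: simplices_def)
    show "map_prod (obj_act D (g \<otimes>\<^bsub>G\<^esub> h)) (map (arr_act D (g \<otimes>\<^bsub>G\<^esub> h))) s =
        map_prod (obj_act D g) (map (arr_act D g)) (map_prod (obj_act D h) (map (arr_act D h)) s)"
      using chainD[OF s(2)] gh
      by (auto simp: s(1) group_action.composition_rule[OF obj_action]
          group_action.composition_rule[OF arr_action])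
  qed
  then show ?thesis by (simp add: finite_gset_def simplex_gset_def finite_simplices)
qed

lemma (in finite_category) finite_nondeg_chain: "finite {ms. length ms = n \<and> nondeg_chain D x ms}"
proof -
  have "{ms. length ms = n \<and> nondeg_chain D x ms} \<subseteq> snd ` simplices D n"
    by (force simp: simplices_def)
  then show ?thesis by (rule finite_subset) (simp add: finite_simplices)
qed

lemma (in finite_category) nondeg_chain_Suc:
  assumes "x \<in> obj D"
  shows "{ms. length ms = Suc n \<and> nondeg_chain D x ms} =
    (\<lambda>(m, ms). m # ms) `
      (SIGMA m:{m \<in> arr D. src D m = x \<and> m \<noteq> idn D x}. {ms. length ms = n \<and> nondeg_chain D (tgt D m) ms})"
  by (force simp: length_Suc_conv image_iff)

lemma (in finite_category) card_nondeg_chain_Suc: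
  assumes "x \<in> obj D"
  shows "card {ms. length ms = Suc n \<and> nondeg_chain D x ms} =
    (\<Sum>m\<in>{m \<in> arr D. src D m = x \<and> m \<noteq> idn D x}. card {ms. length ms = n \<and> nondeg_chain D (tgt D m) ms})"
proof -
  show ?thesis
    unfolding nondeg_chain_Suc[OF assms]
    by (subst card_image) (auto simp: inj_on_def finite_arr finite_nondeg_chain)
qed


section \<open>The category \<open>E\<A>\<^sub>C\<close> is a preorder\<close>

text \<open>A pair \<open>(K, g C\<^sub>G(K))\<close> amounts to the injection \<open>K \<rightarrow> G\<close>, \<open>x \<mapsto> gxg\<^sup>-\<^sup>1\<close>; this is its image.\<close>

definition obj_image :: "('g, 'k) monoid_scheme \<Rightarrow> 'g set \<times> 'g set \<Rightarrow> 'g set"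
  where "obj_image G x = (\<Union>g\<in>snd x. conj_hom G (fst x) g ` fst x)"

locale conj_closed_family = group G for G (structure) +
  fixes C :: "'a set set"
  assumes finite_carrier: "finite (carrier G)"
    and subgroup_mem: "H \<in> C \<Longrightarrow> subgroup H G"
    and conj_closed: "\<lbrakk>H \<in> C; g \<in> carrier G\<rbrakk> \<Longrightarrow> conj_hom G H g ` H \<in> C"
begin

lemma subset_carrier: "H \<in> C \<Longrightarrow> H \<subseteq> carrier G"
  using subgroup.subset[OF subgroup_mem] .

lemma finite_family: "finite C"
  by (rule finite_subset[of _ "Pow (carrier G)"]) (use subset_carrier finite_carrier in auto)

sublocale EA: finite_gcategory G "EA G C"
  using group_axioms finite_carrier subgroup_mem by (rule finite_gcategory_EA)

lemma centralizer_subset: "centralizer G H \<subseteq> carrier G"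
  by (auto simp: centralizer_def)

text \<open>An element of G/C_G(L) is thus the same as a homomorphism x \<mapsto> gxg^-1 on L, and
  cosets are compared by comparing homomorphisms.\<close>

lemma coset_centralizer:
  "\<lbrakk>L \<in> C; g \<in> carrier G\<rbrakk> \<Longrightarrow>
    g <# centralizer G L = {x \<in> carrier G. conj_hom G L x = conj_hom G L g}"
  using conj_hom_eq_iff[OF group_axioms subset_carrier] by simp

text \<open>All elements of the coset induce the same homomorphism, so the union in
  \<open>obj_image\<close> has equal members and any representative computes it.\<close>

lemma obj_image_coset:
  assumes "K \<in> C" "g \<in> carrier G"
  shows "obj_image G (K, g <# centralizer G K) = conj_hom G K g ` K"
proof -
  have "g \<in> g <# centralizer G K" using assms by (simp add: coset_centralizer)
  moreover have "(\<Union>x\<in>g <# centralizer G K. conj_hom G K x ` K) =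
      (\<Union>x\<in>g <# centralizer G K. conj_hom G K g ` K)"
    using assms by (intro SUP_cong refl) (simp add: coset_centralizer)
  ultimately show ?thesis by (auto simp: obj_image_def)
qed

lemma obj_EA: "obj (EA G C) = (SIGMA K:C. lcosets (centralizer G K))"
  by (simp add: EA_def grothendieck_def Let_def op_category_def fusion_category_def coset_gset_def)

lemma objE:
  assumes "x \<in> obj (EA G C)"
  obtains K g where "x = (K, g <# centralizer G K)" "K \<in> C" "g \<in> carrier G"
  using assms by (auto simp: obj_EA LCOSETS_def)

lemma objI: "\<lbrakk>K \<in> C; g \<in> carrier G\<rbrakk> \<Longrightarrow> (K, g <# centralizer G K) \<in> obj (EA G C)"
  by (auto simp: obj_EA LCOSETS_def)

lemma obj_image_mem: "x \<in> obj (EA G C) \<Longrightarrow> obj_image G x \<in> C"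
  by (elim objE) (simp add: obj_image_coset conj_closed)

section \<open>Arrows of the category\<close>

lemma src_EA: "src (EA G C) (x, \<phi>, y) = x"
  and tgt_EA: "tgt (EA G C) (x, \<phi>, y) = y"
  by (simp_all add: EA_def grothendieck_def Let_def)

lemma conj_hom_ext_iff: "conj_hom G L g = conj_hom G L h \<longleftrightarrow> (\<forall>l\<in>L. conj_hom G L g l = conj_hom G L h l)"
  by (auto simp: fun_eq_iff conj_hom_def)

lemma conj_hom_comp:
  assumes "L \<in> C" "g \<in> carrier G" "h \<in> carrier G" "l \<in> L"
  shows "conj_hom G L (h \<otimes> g) l = h \<otimes> conj_hom G L g l \<otimes> inv h"
  using assms subset_carrier[OF assms(1)] by (auto simp: conj_hom_def m_assoc inv_mult_group subset_iff)

text \<open>The arrow goes from K to L, against the underlying homomorphism L \<rightarrow> K. Once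
  a representative h of the source is fixed, g determines the arrow and its target.\<close>

lemma arr_EA_iff:
  assumes "K \<in> C" "h \<in> carrier G" "L \<in> C"
  shows "((K, h <# centralizer G K), \<phi>, (L, b)) \<in> arr (EA G C) \<longleftrightarrow>
    (\<exists>g\<in>carrier G. conj_hom G L g ` L \<subseteq> K \<and> \<phi> = (L, K, conj_hom G L g) \<and>
      b = (h \<otimes> g) <# centralizer G L)"
proof -
  have map: "centralizer_map G (L, K, conj_hom G L g) (h <# centralizer G K) = (h \<otimes> g) <# centralizer G L"
    if "g \<in> carrier G" "conj_hom G L g ` L \<subseteq> K" for g
    using centralizer_map_coset[OF group_axioms] assms subset_carrier that by blast
  have "((K, h <# centralizer G K), \<phi>, (L, b)) \<in> arr (EA G C) \<longleftrightarrow>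
    (\<exists>g\<in>carrier G. conj_hom G L g ` L \<subseteq> K \<and> \<phi> = (L, K, conj_hom G L g) \<and>
      b \<in> lcosets (centralizer G L) \<and> centralizer_map G \<phi> (h <# centralizer G K) = b)"
    using assms
    by (auto simp: EA_def grothendieck_def Let_def op_category_def fusion_category_def coset_gset_def
        LCOSETS_def)
  also have "\<dots> \<longleftrightarrow> (\<exists>g\<in>carrier G. conj_hom G L g ` L \<subseteq> K \<and> \<phi> = (L, K, conj_hom G L g) \<and>
      b = (h \<otimes> g) <# centralizer G L)"
  proof (rule bex_cong[OF refl])
    fix g assume g: "g \<in> carrier G"
    then have "(h \<otimes> g) <# centralizer G L \<in> lcosets (centralizer G L)"
      using assms(2) by (auto simp: LCOSETS_def)
    then show "(conj_hom G L g ` L \<subseteq> K \<and> \<phi> = (L, K, conj_hom G L g) \<and>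
          b \<in> lcosets (centralizer G L) \<and> centralizer_map G \<phi> (h <# centralizer G K) = b) \<longleftrightarrow>
        (conj_hom G L g ` L \<subseteq> K \<and> \<phi> = (L, K, conj_hom G L g) \<and> b = (h \<otimes> g) <# centralizer G L)"
      using map[OF g] by metis
  qed
  finally show ?thesis .
qed

lemma arrE:
  assumes "m \<in> arr (EA G C)"
  obtains K h L g where "K \<in> C" "L \<in> C" "h \<in> carrier G" "g \<in> carrier G" "conj_hom G L g ` L \<subseteq> K"
    "m = ((K, h <# centralizer G K), (L, K, conj_hom G L g), (L, (h \<otimes> g) <# centralizer G L))"
proof -
  obtain x \<phi> y where m: "m = (x, \<phi>, y)" by (cases m) auto
  have "x \<in> obj (EA G C)" "y \<in> obj (EA G C)"
    using EA.src_closed[OF assms] EA.tgt_closed[OF assms] by (simp_all add: m src_EA tgt_EA)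
  then obtain K h L b where "x = (K, h <# centralizer G K)" "K \<in> C" "h \<in> carrier G" "y = (L, b)" "L \<in> C"
    by (metis objE)
  with assms m that show thesis by (auto simp: arr_EA_iff)
qed

text \<open>The image of the target is (hg) L (hg)^-1 = h (g L g^-1) h^-1, which lies in h K
  h^-1.\<close>

lemma obj_image_tgt_subset:
  assumes "m \<in> arr (EA G C)"
  shows "obj_image G (tgt (EA G C) m) \<subseteq> obj_image G (src (EA G C) m)"
  using assms
proof (rule arrE)
  fix K h L g
  assume *: "K \<in> C" "L \<in> C" "h \<in> carrier G" "g \<in> carrier G" "conj_hom G L g ` L \<subseteq> K"
    and m: "m = ((K, h <# centralizer G K), (L, K, conj_hom G L g), (L, (h \<otimes> g) <# centralizer G L))"
  have "conj_hom G L (h \<otimes> g) l \<in> conj_hom G K h ` K" if "l \<in> L" for l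
    using conj_hom_comp[OF *(2,4,3) that] *(5) that by (force simp: conj_hom_def[of G K])
  then show ?thesis using * by (auto simp: m src_EA tgt_EA obj_image_coset)
qed

text \<open>If g and g' give the same target, then hg and hg' induce the same map on L; cancelling
  conjugation by h shows that so do g and g'.\<close>

lemma arr_EA_unique:
  assumes "m \<in> arr (EA G C)" "m' \<in> arr (EA G C)"
    and "src (EA G C) m = src (EA G C) m'" "tgt (EA G C) m = tgt (EA G C) m'"
  shows "m = m'"
proof -
  obtain K h L g where *: "K \<in> C" "L \<in> C" "h \<in> carrier G" "g \<in> carrier G"
    and m: "m = ((K, h <# centralizer G K), (L, K, conj_hom G L g), (L, (h \<otimes> g) <# centralizer G L))"
    using assms(1) by (rule arrE)
  obtain x \<phi> y where m': "m' = (x, \<phi>, y)" by (cases m') auto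
  have "x = (K, h <# centralizer G K)" "y = (L, (h \<otimes> g) <# centralizer G L)"
    using assms(3,4) by (simp_all add: m m' src_EA tgt_EA)
  then obtain g' where g': "g' \<in> carrier G" "\<phi> = (L, K, conj_hom G L g')"
      "(h \<otimes> g) <# centralizer G L = (h \<otimes> g') <# centralizer G L"
    using assms(2) * by (auto simp: m' arr_EA_iff)
  have eq: "conj_hom G L (h \<otimes> g) = conj_hom G L (h \<otimes> g')"
    using g'(3) * g'(1) by (auto simp: coset_centralizer)
  have "conj_hom G L g l = conj_hom G L g' l" for l
  proof (cases "l \<in> L")
    case True
    then have "l \<in> carrier G" using subset_carrier[OF *(2)] by auto
    then have "conj_hom G L g l \<in> carrier G" "conj_hom G L g' l \<in> carrier G"
      using True * g'(1) by (simp_all add: conj_hom_def)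
    then show ?thesis
      using fun_cong[OF eq, of l] True * g'(1) by (simp add: conj_hom_comp)
  qed (simp add: conj_hom_def)
  then have "conj_hom G L g = conj_hom G L g'" ..
  then show ?thesis using g'(2) \<open>x = _\<close> \<open>y = _\<close> by (simp add: m m')
qed

lemma arr_EA_exists:
  assumes "x \<in> obj (EA G C)" "y \<in> obj (EA G C)" and sub: "obj_image G y \<subseteq> obj_image G x"
  shows "\<exists>m\<in>arr (EA G C). src (EA G C) m = x \<and> tgt (EA G C) m = y"
proof -
  obtain K h where x: "x = (K, h <# centralizer G K)" "K \<in> C" "h \<in> carrier G"
    using assms(1) by (rule objE)
  obtain L k where y: "y = (L, k <# centralizer G L)" "L \<in> C" "k \<in> carrier G"
    using assms(2) by (rule objE)
  \<comment> \<open>An arrow given by g has target coset (hg) C_G(L), so g = h^-1 k leads to the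
    coset of k. The inclusion k L k^-1 \<subseteq> h K h^-1 makes it map L into K.\<close>
  have "conj_hom G L (inv h \<otimes> k) l \<in> K" if l: "l \<in> L" for l
  proof -
    have "conj_hom G L k l \<in> conj_hom G K h ` K" using sub l x y by (auto simp: obj_image_coset)
    then obtain z where z: "z \<in> K" "conj_hom G L k l = h \<otimes> z \<otimes> inv h" by (auto simp: conj_hom_def)
    then have "z \<in> carrier G" using subset_carrier x by auto
    then have "conj_hom G L (inv h \<otimes> k) l = z"
      using x y l by (simp add: conj_hom_comp z m_assoc) (simp add: m_assoc[symmetric])
    then show ?thesis using z by simp
  qed
  moreover have "h \<otimes> (inv h \<otimes> k) = k" using x y by (simp add: m_assoc[symmetric])
  ultimately have "(x, (L, K, conj_hom G L (inv h \<otimes> k)), y) \<in> arr (EA G C)"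
    using x y by (auto simp: arr_EA_iff intro!: bexI[of _ "inv h \<otimes> k"])
  then show ?thesis by (force simp: src_EA tgt_EA)
qed

text \<open>Since parallel arrows agree, the identity is the only arrow from x to x, so non-identity
  arrows are those with target different from x.\<close>

lemma tgt_bij:
  assumes "x \<in> obj (EA G C)"
  shows "bij_betw (tgt (EA G C)) {m \<in> arr (EA G C). src (EA G C) m = x \<and> m \<noteq> idn (EA G C) x}
    {y \<in> obj (EA G C). obj_image G y \<subseteq> obj_image G x \<and> y \<noteq> x}"
  unfolding bij_betw_def
proof
  show "inj_on (tgt (EA G C)) {m \<in> arr (EA G C). src (EA G C) m = x \<and> m \<noteq> idn (EA G C) x}"
    by (rule inj_onI, rule arr_EA_unique) auto
  show "tgt (EA G C) ` {m \<in> arr (EA G C). src (EA G C) m = x \<and> m \<noteq> idn (EA G C) x} =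
      {y \<in> obj (EA G C). obj_image G y \<subseteq> obj_image G x \<and> y \<noteq> x}" (is "_ ` ?M = ?Y")
  proof (intro equalityI image_subsetI subsetI)
    fix m assume "m \<in> ?M"
    then have m: "m \<in> arr (EA G C)" "src (EA G C) m = x" "m \<noteq> idn (EA G C) x" by simp_all
    have "m = idn (EA G C) x" if "tgt (EA G C) m = x"
      by (rule arr_EA_unique) (use that m assms EA.idn_closed EA.src_idn EA.tgt_idn in simp_all)
    then show "tgt (EA G C) m \<in> ?Y"
      using m EA.tgt_closed[OF m(1)] obj_image_tgt_subset[OF m(1)] by auto
  next
    fix y assume "y \<in> ?Y"
    then have y: "y \<in> obj (EA G C)" "obj_image G y \<subseteq> obj_image G x" "y \<noteq> x" by simp_all
    obtain m where m: "m \<in> arr (EA G C)" "src (EA G C) m = x" "tgt (EA G C) m = y"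
      using arr_EA_exists[OF assms y(1,2)] by blast
    then have "m \<noteq> idn (EA G C) x" using y(3) EA.tgt_idn[OF assms] by blast
    then show "y \<in> tgt (EA G C) ` ?M" using m by auto
  qed
qed

section \<open>Stabilizers of simplices\<close>

text \<open>g fixes the coset of h iff gh and h induce the same map on K, which means that g
  commutes with every element of h K h^-1.\<close>

lemma obj_act_fixes_iff:
  assumes "x \<in> obj (EA G C)" "g \<in> carrier G"
  shows "obj_act (EA G C) g x = x \<longleftrightarrow> g \<in> centralizer G (obj_image G x)"
proof -
  obtain K h where x: "x = (K, h <# centralizer G K)" "K \<in> C" "h \<in> carrier G"
    using assms(1) by (rule objE)
  have "h <# centralizer G K \<in> lcosets (centralizer G K)" using x by (auto simp: LCOSETS_def)
  then have "obj_act (EA G C) g x = (K, (g \<otimes> h) <# centralizer G K)"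
    using x assms(2)
    by (simp add: EA_def grothendieck_def Let_def op_category_def fusion_category_def coset_gset_def
        lcos_m_assoc[OF centralizer_subset])
  then have "obj_act (EA G C) g x = x \<longleftrightarrow> (g \<otimes> h) <# centralizer G K = h <# centralizer G K"
    using x by simp
  also have "\<dots> \<longleftrightarrow> conj_hom G K (g \<otimes> h) = conj_hom G K h"
    using x assms(2) by (auto simp: coset_centralizer)
  also have "\<dots> \<longleftrightarrow> (\<forall>k\<in>K. conj_hom G K (g \<otimes> h) k = conj_hom G K h k)"
    by (rule conj_hom_ext_iff)
  also have "\<dots> \<longleftrightarrow> (\<forall>k\<in>K. g \<otimes> conj_hom G K h k = conj_hom G K h k \<otimes> g)"
  proof (rule ball_cong[OF refl])
    fix k assume k: "k \<in> K"
    then have "k \<in> carrier G" using subset_carrier x by auto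
    then have "conj_hom G K h k \<in> carrier G" using k x by (simp add: conj_hom_def)
    then show "conj_hom G K (g \<otimes> h) k = conj_hom G K h k \<longleftrightarrow> g \<otimes> conj_hom G K h k = conj_hom G K h k \<otimes> g"
      using k x assms(2) by (simp add: conj_hom_comp inv_solve_right')
  qed
  also have "\<dots> \<longleftrightarrow> g \<in> centralizer G (conj_hom G K h ` K)"
    using assms(2) by (simp add: centralizer_def)
  finally show ?thesis using x(2,3) by (simp add: x(1) obj_image_coset)
qed

lemma centralizer_antimono: "H \<subseteq> K \<Longrightarrow> centralizer G K \<subseteq> centralizer G H"
  by (auto simp: centralizer_def)

text \<open>Along an arrow the image shrinks and its centralizer grows, so g fixes both ends; the
  translated arrow is then parallel to the original and equals it.\<close>

lemma arr_act_fixes: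
  assumes m: "m \<in> arr (EA G C)" and g: "g \<in> centralizer G (obj_image G (src (EA G C) m))"
  shows "arr_act (EA G C) g m = m"
proof (rule arr_EA_unique)
  have gc: "g \<in> carrier G" using g centralizer_subset by blast
  show "arr_act (EA G C) g m \<in> arr (EA G C)" by (rule group_action_memI[OF EA.arr_action gc m])
  show "src (EA G C) (arr_act (EA G C) g m) = src (EA G C) m"
    using g gc m obj_act_fixes_iff EA.src_closed by (simp add: EA.src_act)
  have "g \<in> centralizer G (obj_image G (tgt (EA G C) m))"
    using g centralizer_antimono[OF obj_image_tgt_subset[OF m]] by blast
  then show "tgt (EA G C) (arr_act (EA G C) g m) = tgt (EA G C) m"
    using gc m obj_act_fixes_iff EA.tgt_closed by (simp add: EA.tgt_act)
qed (rule m)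

lemma chain_act_fixes:
  assumes "nondeg_chain (EA G C) x ms" "g \<in> centralizer G (obj_image G x)"
  shows "map (arr_act (EA G C) g) ms = ms"
  using assms
proof (induction ms arbitrary: x)
  case (Cons m ms)
  then have m: "m \<in> arr (EA G C)" "src (EA G C) m = x" and ms: "nondeg_chain (EA G C) (tgt (EA G C) m) ms"
    by auto
  then have "g \<in> centralizer G (obj_image G (tgt (EA G C) m))"
    using Cons.prems(2) centralizer_antimono[OF obj_image_tgt_subset[OF m(1)]] by blast
  then show ?case using Cons.IH[OF ms] arr_act_fixes[OF m(1)] m(2) Cons.prems(2) by simp
qed simp

lemma chain_obj: "nondeg_chain (EA G C) x ms \<Longrightarrow> x \<in> obj (EA G C)"
  using EA.src_closed by (cases ms) auto

lemma stabilizer_simplex: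
  assumes "s \<in> fst (simplex_gset (EA G C) n)"
  shows "stabilizer G (snd (simplex_gset (EA G C) n)) s = centralizer G (obj_image G (fst s))"
proof -
  obtain x ms where s: "s = (x, ms)" "nondeg_chain (EA G C) x ms"
    using assms by (auto simp: simplex_gset_def simplices_def)
  then have x: "x \<in> obj (EA G C)" using chain_obj by blast
  \<comment> \<open>The initial object is part of the simplex, so fixing the simplex forces fixing
    that object, also in dimension 0. The converse propagates along the chain.\<close>
  have "snd (simplex_gset (EA G C) n) g s = s \<longleftrightarrow> g \<in> centralizer G (obj_image G x)"
    if "g \<in> carrier G" for g
    using assms obj_act_fixes_iff[OF x that] chain_act_fixes[OF s(2)]
    by (auto simp: simplex_gset_def s(1))
  then show ?thesis using centralizer_subset by (auto simp: stabilizer_def s(1))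
qed

section \<open>Counting the objects over a subgroup\<close>

text \<open>The centralizer of g K g^-1 is g C_G(K) g^-1. Objects over one subgroup H carry left
  cosets of different centralizers; all of these become right cosets of the single group
  C_G(H).\<close>

lemma centralizer_rcoset:
  assumes "K \<in> C" "g \<in> carrier G"
  shows "centralizer G (conj_hom G K g ` K) #> g = g <# centralizer G K"
proof (intro Set.set_eqI iffI)
  have conj: "centralizer G (conj_hom G K g ` K) =
      {x \<in> carrier G. conj_hom G K (x \<otimes> g) = conj_hom G K g}"
  proof -
    have "x \<otimes> conj_hom G K g k = conj_hom G K g k \<otimes> x \<longleftrightarrow> conj_hom G K (x \<otimes> g) k = conj_hom G K g k"
      if "x \<in> carrier G" "k \<in> K" for x k
    proof -
      have "k \<in> carrier G" using that subset_carrier assms by auto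
      then have "conj_hom G K g k \<in> carrier G" using that assms by (simp add: conj_hom_def)
      then show ?thesis using that assms by (simp add: conj_hom_comp inv_solve_right')
    qed
    then show ?thesis by (auto simp: centralizer_def conj_hom_ext_iff)
  qed
  fix y
  show "y \<in> g <# centralizer G K" if "y \<in> centralizer G (conj_hom G K g ` K) #> g"
    using that assms by (auto simp: r_coset_def conj coset_centralizer)
  assume "y \<in> g <# centralizer G K"
  then have y: "y \<in> carrier G" "conj_hom G K y = conj_hom G K g"
    using assms by (auto simp: coset_centralizer)
  have "y = (y \<otimes> inv g) \<otimes> g" using y assms by (simp add: m_assoc)
  moreover from this have "y \<otimes> inv g \<in> centralizer G (conj_hom G K g ` K)"
    using y assms by (simp add: conj)
  ultimately show "y \<in> centralizer G (conj_hom G K g ` K) #> g"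
    unfolding r_coset_def by blast
qed

lemma conj_hom_inv_image:
  assumes "H \<in> C" "g \<in> carrier G"
  shows "conj_hom G (conj_hom G H (inv g) ` H) g ` (conj_hom G H (inv g) ` H) = H"
proof -
  have "g \<otimes> (inv g \<otimes> h \<otimes> g) \<otimes> inv g = h" if "h \<in> carrier G" for h
    using that assms(2) by (simp add: m_assoc) (simp add: m_assoc[symmetric])
  then show ?thesis
    using assms subset_carrier[OF assms(1)] by (auto simp: conj_hom_def image_iff subset_iff)
qed

text \<open>An object (K, a) over H is determined by a, because K = g^-1 H g for any g in a; and the
  possible a are exactly the right cosets of C_G(H).\<close>

lemma card_obj_image_fiber:
  assumes H: "H \<in> C"
  shows "card {x \<in> obj (EA G C). obj_image G x = H} = card (lcosets (centralizer G H))"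
proof -
  let ?F = "{x \<in> obj (EA G C). obj_image G x = H}"
  have fiber: "snd x = centralizer G H #> g" "conj_hom G H (inv g) ` H = fst x"
    if "x \<in> ?F" "g \<in> snd x" for x g
  proof -
    have "x \<in> obj (EA G C)" using that(1) by simp
    then obtain K h where x: "x = (K, h <# centralizer G K)" "K \<in> C" "h \<in> carrier G"
      by (rule objE)
    then have g: "g \<in> carrier G" "conj_hom G K g = conj_hom G K h"
      using that(2) by (simp_all add: coset_centralizer)
    then have "snd x = g <# centralizer G K" using x by (simp add: coset_centralizer)
    note g = g(1) this
    then have "conj_hom G K g ` K = H" using that(1) x by (auto simp: obj_image_coset)
    then show "snd x = centralizer G H #> g" using g x centralizer_rcoset[of K g] by simp
    show "conj_hom G H (inv g) ` H = fst x"
      using conj_hom_inv_image[of K "inv g"] g x \<open>conj_hom G K g ` K = H\<close> by simp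
  qed
  have self: "\<exists>g. g \<in> snd x" if "x \<in> ?F" for x
    using that by (auto elim!: objE) (auto simp: coset_centralizer)
  have "bij_betw snd ?F (rcosets (centralizer G H))"
    unfolding bij_betw_def
  proof
    show "inj_on snd ?F"
    proof (rule inj_onI)
      fix x y assume xy: "x \<in> ?F" "y \<in> ?F" and eq: "snd x = snd y"
      obtain g where "g \<in> snd x" using self[OF xy(1)] by blast
      then have "fst x = fst y" using fiber(2)[OF xy(1)] fiber(2)[OF xy(2)] eq by metis
      then show "x = y" using eq by (simp add: prod_eq_iff)
    qed
    show "snd ` ?F = rcosets (centralizer G H)"
    proof
      show "snd ` ?F \<subseteq> rcosets (centralizer G H)"
      proof
        fix a assume "a \<in> snd ` ?F"
        then obtain x where x: "x \<in> ?F" and a: "a = snd x" by blast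
        obtain g where g: "g \<in> snd x" using self[OF x] by blast
        then have "g \<in> carrier G" using x by (auto elim!: objE simp: coset_centralizer)
        then show "a \<in> rcosets (centralizer G H)"
          using fiber(1)[OF x g] by (auto simp: a RCOSETS_def)
      qed
      show "rcosets (centralizer G H) \<subseteq> snd ` ?F"
      proof
        fix a assume "a \<in> rcosets (centralizer G H)"
        then obtain g where g: "g \<in> carrier G" and a: "a = centralizer G H #> g"
          by (auto simp: RCOSETS_def)
        let ?K = "conj_hom G H (inv g) ` H"
        have K: "?K \<in> C" using H g by (simp add: conj_closed)
        have "a = g <# centralizer G ?K"
          using centralizer_rcoset[OF K g] conj_hom_inv_image[OF H g] by (simp add: a)
        moreover have "obj_image G (?K, g <# centralizer G ?K) = H"
          using obj_image_coset[OF K g] conj_hom_inv_image[OF H g] by simp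
        ultimately show "a \<in> snd ` ?F" using objI[OF K g] by force
      qed
    qed
  qed
  then have "card ?F = card (rcosets (centralizer G H))" by (rule bij_betw_same_card)
  moreover have "subgroup (centralizer G H) G"
    using subgroup_centralizer[OF group_axioms subset_carrier[OF H]] .
  \<comment> \<open>Left and right cosets are equally many, as both counts times the order of the
    centralizer give the order of G.\<close>
  then have "card (rcosets (centralizer G H)) * card (centralizer G H) =
      card (lcosets (centralizer G H)) * card (centralizer G H)"
    using lagrange_finite[OF finite_carrier] l_lagrange[OF finite_carrier] by simp
  moreover have "card (centralizer G H) \<noteq> 0"
    using \<open>subgroup (centralizer G H) G\<close> finite_carrier
    by (metis card_0_eq empty_iff finite_subset subgroup.one_closed subgroup.subset)
  ultimately show ?thesis by simp
qed

section \<open>Counting simplices and evaluating the series\<close>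

definition coset_count :: "'a set \<Rightarrow> rat"
  where "coset_count H = of_nat (card (lcosets (centralizer G H)))"

lemma coset_count_nonzero: "H \<in> C \<Longrightarrow> coset_count H \<noteq> 0"
proof -
  have "finite (lcosets (centralizer G H))" using finite_carrier by (simp add: LCOSETS_def)
  then show ?thesis by (auto simp: coset_count_def LCOSETS_def)
qed

text \<open>The inner sum of a constant is kept unevaluated, so the same regrouping serves rational
  numbers and finitely supported functions.\<close>

lemma sum_obj_image:
  fixes f :: "'a set \<Rightarrow> 'c::comm_monoid_add"
  shows "(\<Sum>x\<in>obj (EA G C). f (obj_image G x)) =
    (\<Sum>H\<in>C. \<Sum>x\<in>{x \<in> obj (EA G C). obj_image G x = H}. f H)"
proof -
  have "(\<Sum>H\<in>C. \<Sum>x\<in>{x \<in> obj (EA G C). obj_image G x = H}. f (obj_image G x)) =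
      (\<Sum>x\<in>obj (EA G C). f (obj_image G x))"
    using obj_image_mem by (intro sum.group EA.finite_obj finite_family) auto
  then show ?thesis by simp
qed

text \<open>By \<open>tgt_bij\<close> the first arrow amounts to its target, and the number of
  continuations depends only on the image of that target.\<close>

lemma card_chains:
  assumes "x \<in> obj (EA G C)"
  shows "of_nat (card {ms. length ms = n \<and> nondeg_chain (EA G C) x ms}) =
    chain_weight C coset_count n (obj_image G x)"
  using assms
proof (induction n arbitrary: x)
  case 0
  then have "{ms. length ms = 0 \<and> nondeg_chain (EA G C) x ms} = {[]}" by auto
  then show ?case by simp
next
  case (Suc n)
  let ?c = "\<lambda>y. chain_weight C coset_count n (obj_image G y)" and ?H = "obj_image G x"
  let ?S = "{y \<in> obj (EA G C). obj_image G y \<subseteq> ?H}"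
  have fin: "finite ?S" using EA.finite_obj by simp
  have "of_nat (card {ms. length ms = Suc n \<and> nondeg_chain (EA G C) x ms}) =
      (\<Sum>m\<in>{m \<in> arr (EA G C). src (EA G C) m = x \<and> m \<noteq> idn (EA G C) x}. ?c (tgt (EA G C) m))"
    using Suc.IH EA.tgt_closed by (simp add: EA.card_nondeg_chain_Suc[OF Suc.prems])
  also have "\<dots> = (\<Sum>y\<in>{y \<in> obj (EA G C). obj_image G y \<subseteq> ?H \<and> y \<noteq> x}. ?c y)"
    using sum.reindex_bij_betw[OF tgt_bij[OF Suc.prems], of ?c] .
  also have "{y \<in> obj (EA G C). obj_image G y \<subseteq> ?H \<and> y \<noteq> x} = ?S - {x}" by auto
  \<comment> \<open>The object x is one of the objects over its own image; removing it lowers that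
    single weight by 1, which is the \<open>of_bool\<close> term of
    \<open>chain_weight\<close>.\<close>
  also have "(\<Sum>y\<in>?S - {x}. ?c y) = (\<Sum>y\<in>?S. ?c y) - ?c x"
    using fin Suc.prems by (subst sum_diff1) auto
  also have "(\<Sum>y\<in>?S. ?c y) =
      (\<Sum>y\<in>obj (EA G C). if obj_image G y \<subseteq> ?H then chain_weight C coset_count n (obj_image G y) else 0)"
    using EA.finite_obj by (simp add: sum.inter_filter)
  also have "\<dots> = (\<Sum>K\<in>C. if K \<subseteq> ?H then coset_count K * chain_weight C coset_count n K else 0)"
    unfolding sum_obj_image[of "\<lambda>K. if K \<subseteq> ?H then chain_weight C coset_count n K else 0"]
    by (intro sum.cong refl) (simp add: card_obj_image_fiber coset_count_def)
  also have "\<dots> = (\<Sum>K\<in>{K \<in> C. K \<subseteq> ?H}. coset_count K * chain_weight C coset_count n K)"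
    using finite_family by (simp add: sum.inter_filter)
  also have "\<dots> - ?c x = chain_weight C coset_count (Suc n) ?H"
  proof -
    have "(\<Sum>K\<in>{K \<in> C. K \<subseteq> ?H}. of_bool (K = ?H) * chain_weight C coset_count n K) = ?c x"
      using finite_family obj_image_mem[OF Suc.prems] by (subst sum.remove[of _ ?H]) auto
    then show ?thesis by (simp add: left_diff_distrib sum_subtractf)
  qed
  finally show ?case .
qed

text \<open>Each simplex over H has weight 1 / w(H), and w(H) objects lie over H, so the two factors
  cancel and the number of chains from one object remains.\<close>

lemma burnside_class_simplex:
  "burnside_class G (simplex_gset (EA G C) n) =
    quot_class G (\<Sum>H\<in>C. scale (chain_weight C coset_count n H) (free_class G (coset_gset G (centralizer G H))))"
proof -
  let ?t = "\<lambda>H. scale (1 / coset_count H) (free_class G (coset_gset G (centralizer G H)))"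
  let ?ch = "\<lambda>x. {ms. length ms = n \<and> nondeg_chain (EA G C) x ms}"
  have simp_eq: "fst (simplex_gset (EA G C) n) = (SIGMA x:obj (EA G C). ?ch x)"
    using chain_obj by (auto simp: simplex_gset_def simplices_def)
  have "free_class G (simplex_gset (EA G C) n) -
      (\<Sum>s\<in>fst (simplex_gset (EA G C) n). ?t (obj_image G (fst s))) \<in> burnside_relations G"
    using free_class_stabilizers[OF EA.finite_gset_simplex stabilizer_simplex]
    by (simp add: coset_count_def)
  moreover have "(\<Sum>s\<in>fst (simplex_gset (EA G C) n). ?t (obj_image G (fst s))) =
      (\<Sum>H\<in>C. scale (chain_weight C coset_count n H) (free_class G (coset_gset G (centralizer G H))))"
  proof -
    have const: "(\<Sum>a\<in>A. u) = scale (of_nat (card A)) u" for A :: "'z set" and u :: "'y \<Rightarrow>\<^sub>0 rat"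
      using scale.scale_sum_left[of "\<lambda>_. 1" A u] by simp
    have "(\<Sum>s\<in>fst (simplex_gset (EA G C) n). ?t (obj_image G (fst s))) =
        (\<Sum>x\<in>obj (EA G C). \<Sum>ms\<in>?ch x. ?t (obj_image G x))"
      unfolding simp_eq using EA.finite_obj EA.finite_nondeg_chain by (subst sum.Sigma) (auto intro!: sum.cong)
    also have "\<dots> = (\<Sum>x\<in>obj (EA G C).
        scale (chain_weight C coset_count n (obj_image G x)) (?t (obj_image G x)))"
      by (intro sum.cong refl) (simp only: const card_chains)
    also have "\<dots> = (\<Sum>H\<in>C. scale (coset_count H) (scale (chain_weight C coset_count n H) (?t H)))"
      unfolding sum_obj_image[of "\<lambda>H. scale (chain_weight C coset_count n H) (?t H)"]
      by (intro sum.cong refl) (simp only: const card_obj_image_fiber coset_count_def)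
    also have "\<dots> = (\<Sum>H\<in>C. scale (chain_weight C coset_count n H) (free_class G (coset_gset G (centralizer G H))))"
      by (intro sum.cong refl) (simp add: coset_count_nonzero)
    finally show ?thesis .
  qed
  ultimately show ?thesis by (simp add: burnside_class_eq quot_class_eq_iff)
qed

lemma keys_coset_class:
  assumes "H \<in> C"
  shows "Poly_Mapping.keys (free_class G (coset_gset G (centralizer G H))) \<subseteq> iso_classes G"
  using iso_class_in_iso_classes[OF finite_gset_coset[OF group_axioms finite_carrier
        subgroup_centralizer[OF group_axioms subset_carrier[OF assms]]]] by simp

lemma has_value_EA:
  "has_value_at_minus_one G (simplex_series G (EA G C))
    (quot_class G (\<Sum>H\<in>C. scale (- of_int (mobius (add_minimum C) None (Some H)) / coset_count H)
      (free_class G (coset_gset G (centralizer G H)))))"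
proof -
  let ?u = "\<lambda>H. free_class G (coset_gset G (centralizer G H))"
  let ?v = "\<lambda>H. - of_int (mobius (add_minimum C) None (Some H)) / coset_count H"
  have "\<exists>r\<in>regular_at_minus_one. ratfun_laurent r = fps_to_fls (Abs_fps (\<lambda>n. chain_weight C coset_count n H))
      \<and> ratfun_eval r (- 1) = ?v H" if "H \<in> C" for H
    using series_value_chain_weight[OF finite_family coset_count_nonzero that]
    by (intro series_value_ratfun) auto
  then obtain r where r: "\<And>H. H \<in> C \<Longrightarrow> r H \<in> regular_at_minus_one"
      "\<And>H. H \<in> C \<Longrightarrow> ratfun_laurent (r H) = fps_to_fls (Abs_fps (\<lambda>n. chain_weight C coset_count n H))"
      "\<And>H. H \<in> C \<Longrightarrow> ratfun_eval (r H) (- 1) = ?v H"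
    by metis
  \<comment> \<open>\<open>has_value_at_minus_one\<close> indexes its tensors by an initial segment
    of the natural numbers, so C is enumerated.\<close>
  obtain e where e: "bij_betw e {..<card C} C"
    using ex_bij_betw_nat_finite[OF finite_family] by (auto simp: atLeast0LessThan)
  have eC: "e i \<in> C" if "i < card C" for i using e that by (auto dest: bij_betw_apply)
  have "simplex_series G (EA G C) n =
      quot_class G (\<Sum>i<card C. scale (fls_nth (ratfun_laurent (r (e i))) n) (?u (e i)))" for n
  proof -
    have "(\<Sum>i<card C. scale (fls_nth (ratfun_laurent (r (e i))) n) (?u (e i))) =
        (\<Sum>H\<in>C. scale (fls_nth (ratfun_laurent (r H)) n) (?u H))"
      using sum.reindex_bij_betw[OF e] .
    \<comment> \<open>Coefficients of negative index vanish on this side too, in agreement with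
      \<open>simplex_series\<close>.\<close>
    also have "\<dots> = (\<Sum>H\<in>C. scale (if n < 0 then 0 else chain_weight C coset_count (nat n) H) (?u H))"
      by (intro sum.cong refl) (simp add: r)
    finally show ?thesis
      by (simp add: simplex_series_def zero_burnside burnside_class_simplex)
  qed
  moreover have "(\<Sum>i<card C. scale (ratfun_eval (r (e i)) (- 1)) (?u (e i))) =
      (\<Sum>H\<in>C. scale (?v H) (?u H))"
    using sum.reindex_bij_betw[OF e, of "\<lambda>H. scale (ratfun_eval (r H) (- 1)) (?u H)"] r(3) by simp
  ultimately show ?thesis
    unfolding has_value_at_minus_one_iff
    by (intro exI[of _ "card C"] exI[of _ "\<lambda>i. ?u (e i)"] exI[of _ "\<lambda>i. r (e i)"])
      (use eC r(1) keys_coset_class in simp)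
qed

end

theorem theoremB:
  fixes G :: "('g, 'k) monoid_scheme" and C :: "'g set set"
  assumes "group G" and "finite (carrier G)"
    and "\<And>H. H \<in> C \<Longrightarrow> subgroup H G"
    and "\<And>H g. H \<in> C \<Longrightarrow> g \<in> carrier G \<Longrightarrow> conj_hom G H g ` H \<in> C"
  shows "has_series_lefschetz G (EA G C) \<and>
    series_lefschetz G (EA G C) =
      (\<Oplus>\<^bsub>burnside_ring G\<^esub> H\<in>C.
         (- of_int (mobius (add_minimum C) None (Some H))
            / of_nat (card (lcosets\<^bsub>G\<^esub> (centralizer G H))))
         \<odot>\<^bsub>burnside_ring G\<^esub> burnside_class G (coset_gset G (centralizer G H)))"
proof -
  interpret conj_closed_family G C
    using assms by (simp add: conj_closed_family_def conj_closed_family_axioms_def)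
  let ?v = "quot_class G (\<Sum>H\<in>C. scale (- of_int (mobius (add_minimum C) None (Some H)) / coset_count H)
      (free_class G (coset_gset G (centralizer G H))))"
  have "series_lefschetz G (EA G C) = ?v"
    unfolding series_lefschetz_def
    using has_value_EA has_value_at_minus_one_unique by (intro the_equality)
  moreover have "has_series_lefschetz G (EA G C)"
    unfolding has_series_lefschetz_def using has_value_EA EA.finite_gcategory_axioms by blast
  ultimately show ?thesis
    by (simp only: burnside_class_eq coset_count_def finsum_smult_burnside[OF keys_coset_class refl])
qed

end
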